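(* Let $G=M\bowtie_\gamma H$ be the cocycle double cross product of a cocycle matched pair $(M,H)$, with Lie algebra $T_oM\bowtie_\theta\mathfrak h$. Given a Lagrangian $\mathcal L=\mathcal L(m,h,v,\eta)$ defined on $(M\bowtie_\gamma H)\ltimes(T_oM\bowtie_\theta\mathfrak h)$, the (trivialized) Euler-Lagrange equations are given by $$\frac{d}{dt}\frac{\delta\mathcal L}{\delta v}=\Big(T^*\mathfrak L_m\big(\tfrac{\delta\mathcal L}{\delta m}\big)\Big)\overset{*}{\triangleleft}h+\Big(T^*(R_h\circ\gamma_m)\big(\tfrac{\delta\mathcal L}{\delta h}\big)\Big)\overset{*}{\triangleleft}h+T^*\sigma_h\big(\tfrac{\delta\mathcal L}{\delta h}\big)-\mathfrak{ad}^*_v\big(\tfrac{\delta\mathcal L}{\delta v}\big)+\big(\tfrac{\delta\mathcal L}{\delta v}\big)\overset{*}{\triangleleft}\eta+\mathfrak a^*_\eta\big(\tfrac{\delta\mathcal L}{\delta\eta}\big)+\theta^*_v\big(\tfrac{\delta\mathcal L}{\delta\eta}\big),$$ $$\frac{d}{dt}\frac{\delta\mathcal L}{\delta\eta}=T^*L_h\big(\tfrac{\delta\mathcal L}{\delta h}\big)-\mathrm{ad}^*_\eta\big(\tfrac{\delta\mathcal L}{\delta\eta}\big)-\mathfrak b^*_v\big(\tfrac{\delta\mathcal L}{\delta v}\big)-{}_v\psi^*\big(\tfrac{\delta\mathcal L}{\delta\eta}\big).$$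
   Context: Cocycle matched pair. $M$ is a smooth manifold with a distinguished element $o$, $H$ is a Lie group (product $*$, identity $1$, Lie algebra $\mathfrak h$) with a smooth left action $H\times M\to M$, $(h,m)\mapsto h\triangleright m$, satisfying $h\triangleright o=o$. There are smooth maps $\sigma:H\times M\to H$, $\Phi:M\times M\to M$ (written $m_1\cdot m_2$), $\gamma:M\times M\to H$ with $\sigma(h,o)=h$, $\sigma(1,m)=1$, $\gamma(o,o)=1$, and (i) $o\cdot m=m=m\cdot o$; (ii) $\gamma(m,o)=1=\gamma(o,m)$; (iii) $h\triangleright(m_1\cdot m_2)=(h\triangleright m_1)\cdot(\sigma(h,m_1)\triangleright m_2)$; (iv) $\sigma(h,m_1\cdot m_2)*\gamma(m_1,m_2)=\gamma(h\triangleright m_1,\sigma(h,m_1)\triangleright m_2)*\sigma(\sigma(h,m_1),m_2)$; (v) $\sigma(h_1*h_2,m)=\sigma(h_1,h_2\triangleright m)*\sigma(h_2,m)$; (vi) $m_1\cdot(m_2\cdot m_3)=(m_1\cdot m_2)\cdot(\gamma(m_1,m_2)\triangleright m_3)$; (vii) $\gamma(m_1,m_2\cdot m_3)*\gamma(m_2,m_3)=\gamma(m_1\cdot m_2,\gamma(m_1,m_2)\triangleright m_3)*\sigma(\gamma(m_1,m_2),m_3)$; (viii) for each $m\in M$ there is $m^r\in M$ with $m\cdot m^r=o$. Then (known) $M\bowtie_\gamma H:=M\times H$ is a Lie group with identity $(o,1)$ and product $$(m_1,h_1)(m_2,h_2)=\big(m_1\cdot(h_1\triangleright m_2),\ \gamma(m_1,h_1\triangleright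 m_2)*\sigma(h_1,m_2)*h_2\big),$$ called the cocycle double cross product. Lie algebra. The Lie algebra of $G=M\bowtie_\gamma H$ is $T_oM\oplus\mathfrak h$ as a vector space, with $\mathfrak h$ a subalgebra; it is denoted $T_oM\bowtie_\theta\mathfrak h$. Define bilinear maps by decomposing brackets into components in $T_oM$ and $\mathfrak h$: $[\eta,v]=\eta\triangleright v+\psi(\eta,v)$ and $[v_1,v_2]=[[v_1,v_2]]+\theta(v_1,v_2)$ for $v,v_1,v_2\in T_oM$, $\eta\in\mathfrak h$. Thus $$[(v_1,\eta_1),(v_2,\eta_2)]=\big([[v_1,v_2]]+\eta_1\triangleright v_2-\eta_2\triangleright v_1,\ [\eta_1,\eta_2]+\psi(\eta_1,v_2)-\psi(\eta_2,v_1)+\theta(v_1,v_2)\big).$$ Maps. $\mathfrak L_m:M\to M$, $n\mapsto m\cdot n$; $\gamma_m:M\to H$, $n\mapsto\gamma(m,n)$; $\sigma_h:M\to H$, $m\mapsto\sigma(h,m)$; $L_h,R_h$ are left and right translations on $H$. For smooth $f$, $T^*f$ is the transpose of the tangent map $Tf$. Here $T^*\mathfrak L_m$, $T^*(R_h\circ\gamma_m)$ and $T^*\sigma_h$ are taken at $o\in M$, and $T^*L_h$ at $1\in H$. For $\alpha\in T_o^*M$: $\langle\alpha\overset{*}{\triangleleft}h,w\rangle=\langle\alpha,h\triangleright w\rangle$ (where $h\triangleright w$ is the tangent map at $o$ of $n\mapsto h\triangleright n$ applied to $w$), and $\langle\alpha\overset{*}{\triangleleft}\eta,w\rangle=\langle\alpha,\eta\triangleright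 w\rangle$. The linear maps $\mathfrak a_\eta:T_oM\to\mathfrak h$, $v\mapsto\psi(\eta,v)$; $\mathfrak b_v:\mathfrak h\to T_oM$, $\eta\mapsto\eta\triangleright v$; ${}_v\psi:\mathfrak h\to\mathfrak h$, $\eta\mapsto\psi(\eta,v)$; $\theta_v:T_oM\to\mathfrak h$, $w\mapsto\theta(v,w)$ have transposes $\mathfrak a_\eta^*,\mathfrak b_v^*,{}_v\psi^*,\theta_v^*$ (no sign). In contrast $\langle\mathfrak{ad}^*_v\alpha,w\rangle=-\langle\alpha,[[v,w]]\rangle$ and, for any Lie algebra, $\langle\mathrm{ad}^*_\xi\mu,\zeta\rangle=-\langle\mu,[\xi,\zeta]\rangle$. Euler-Lagrange equations. For a Lie group $G$ with Lie algebra $\mathfrak g$, $TG$ is identified with $G\ltimes\mathfrak g$ by left trivialization, and the (trivialized) Euler-Lagrange equations of $\mathcal L=\mathcal L(g,\xi)$ on $G\ltimes\mathfrak g$ are $$\frac{d}{dt}\frac{\delta\mathcal L}{\delta\xi}=T^*L_g\Big(\frac{\delta\mathcal L}{\delta g}\Big)-\mathrm{ad}^*_\xi\Big(\frac{\delta\mathcal L}{\delta\xi}\Big),$$ where $\delta\mathcal L/\delta\xi\in\mathfrak g^*$, $\delta\mathcal L/\delta g\in T_g^*G$ are the partial derivatives and $T^*L_g:T_g^*G\to\mathfrak g^*$. In the claim $g=(m,h)$, $\xi=(v,\eta)$, and the partial derivatives lie in $T_m^*M$, $T_h^*H$, $T_o^*M$, $\mathfrak h^*$. *)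

theory Defs
  imports "HOL-Analysis.Analysis"
begin

section \<open>Smooth maps between normed spaces\<close>

text \<open>Derivatives are taken direction by direction, so that the type of the function does not
  change. On open subsets of finite-dimensional spaces, the only place where these notions are
  used, this is the usual \<open>C\<^sup>n\<close> resp. \<open>C\<^sup>\<infinity>\<close>.\<close>

primrec C_n_on :: "nat \<Rightarrow> 'a::real_normed_vector set \<Rightarrow> ('a \<Rightarrow> 'b::real_normed_vector) \<Rightarrow> bool" where
  "C_n_on 0 S f \<longleftrightarrow> continuous_on S f"
| "C_n_on (Suc n) S f \<longleftrightarrow> (\<forall>x\<in>S. f differentiable (at x)) \<and>
     (\<forall>w. C_n_on n S (\<lambda>x. frechet_derivative f (at x) w))"

definition smooth_on :: "'a::real_normed_vector set \<Rightarrow> ('a \<Rightarrow> 'b::real_normed_vector) \<Rightarrow> bool" where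
  "smooth_on S f \<longleftrightarrow> (\<forall>n. C_n_on n S f)"

section \<open>Manifolds\<close>

type_synonym ('m, 'e) chart = "'m set \<times> ('m \<Rightarrow> 'e)"

definition chart_inv :: "('m, 'e) chart \<Rightarrow> 'e \<Rightarrow> 'm" where
  "chart_inv c = inv_into (fst c) (snd c)"

text \<open>Besides an atlas, the data contain an arbitrary choice of a chart around every point.
  Its only purpose is to represent the tangent space at \<open>p\<close> by the model space: a vector
  \<open>w :: 'e\<close> stands for the tangent vector at \<open>p\<close> whose coordinate expression in
  \<open>chart_at M p\<close> is \<open>w\<close>. Cotangent vectors at \<open>p\<close> are then elements of the normed dual
  \<open>'e \<Rightarrow>\<^sub>L real\<close>.\<close>

record ('m, 'e) manifold_data =
  atlas :: "('m, 'e) chart set"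
  chart_at :: "'m \<Rightarrow> ('m, 'e) chart"

text \<open>The model space is a finite-dimensional normed space rather than a \<open>euclidean_space\<close>,
  because the latter class excludes dimension 0.\<close>

definition smooth_manifold ::
  "('m::{t2_space,second_countable_topology}, 'e::real_normed_vector) manifold_data \<Rightarrow> bool" where
  "smooth_manifold M \<longleftrightarrow>
     (\<exists>B::'e set. finite B \<and> span B = UNIV) \<and>
     (\<forall>(U, \<phi>) \<in> atlas M. open U \<and> open (\<phi> ` U) \<and>
        homeomorphism U (\<phi> ` U) \<phi> (chart_inv (U, \<phi>))) \<and>
     (\<forall>(U, \<phi>) \<in> atlas M. \<forall>(V, \<psi>) \<in> atlas M.
        smooth_on (\<phi> ` (U \<inter> V)) (\<psi> \<circ> chart_inv (U, \<phi>))) \<and>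
     (\<forall>p. chart_at M p \<in> atlas M \<and> p \<in> fst (chart_at M p))"

definition vs_manifold :: "('e, 'e) manifold_data" where
  "vs_manifold = \<lparr>atlas = {(UNIV, id)}, chart_at = (\<lambda>_. (UNIV, id))\<rparr>"

definition prod_chart :: "('m, 'e) chart \<Rightarrow> ('n, 'f) chart \<Rightarrow> ('m \<times> 'n, 'e \<times> 'f) chart" where
  "prod_chart c d = (fst c \<times> fst d, map_prod (snd c) (snd d))"

text \<open>With this choice of charts the tangent space of \<open>M \<times> N\<close> at \<open>(p, q)\<close> is the product
  \<open>'e \<times> 'f\<close> of the tangent spaces at \<open>p\<close> and \<open>q\<close>.\<close>

definition prod_manifold ::
  "('m, 'e) manifold_data \<Rightarrow> ('n, 'f) manifold_data \<Rightarrow> ('m \<times> 'n, 'e \<times> 'f) manifold_data" where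
  "prod_manifold M N = \<lparr>atlas = {prod_chart c d | c d. c \<in> atlas M \<and> d \<in> atlas N},
     chart_at = (\<lambda>(p, q). prod_chart (chart_at M p) (chart_at N q))\<rparr>"

text \<open>Smoothness on an open subset \<open>S\<close> of \<open>M\<close>.\<close>

definition smooth_map_on ::
  "('m::topological_space, 'e::real_normed_vector) manifold_data \<Rightarrow>
   ('n::topological_space, 'f::real_normed_vector) manifold_data \<Rightarrow> 'm set \<Rightarrow> ('m \<Rightarrow> 'n) \<Rightarrow> bool" where
  "smooth_map_on M N S f \<longleftrightarrow> continuous_on S f \<and>
     (\<forall>(U, \<phi>) \<in> atlas M. \<forall>(V, \<psi>) \<in> atlas N.
        smooth_on (\<phi> ` (S \<inter> U \<inter> f -` V)) (\<psi> \<circ> f \<circ> chart_inv (U, \<phi>)))"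

abbreviation smooth_map ::
  "('m::topological_space, 'e::real_normed_vector) manifold_data \<Rightarrow>
   ('n::topological_space, 'f::real_normed_vector) manifold_data \<Rightarrow> ('m \<Rightarrow> 'n) \<Rightarrow> bool" where
  "smooth_map M N \<equiv> smooth_map_on M N UNIV"

definition tangent_map ::
  "('m, 'e::real_normed_vector) manifold_data \<Rightarrow> ('n, 'f::real_normed_vector) manifold_data \<Rightarrow>
   ('m \<Rightarrow> 'n) \<Rightarrow> 'm \<Rightarrow> 'e \<Rightarrow>\<^sub>L 'f" where
  "tangent_map M N f p =
     Blinfun (frechet_derivative (snd (chart_at N (f p)) \<circ> f \<circ> chart_inv (chart_at M p))
       (at (snd (chart_at M p) p)))"

text \<open>The transpose \<open>T\<^sup>*f\<close> of the tangent map of \<open>f\<close> at \<open>p\<close>, from covectors at \<open>f p\<close> to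
  covectors at \<open>p\<close>.\<close>

definition cotangent_map ::
  "('m, 'e::real_normed_vector) manifold_data \<Rightarrow> ('n, 'f::real_normed_vector) manifold_data \<Rightarrow>
   ('m \<Rightarrow> 'n) \<Rightarrow> 'm \<Rightarrow> ('f \<Rightarrow>\<^sub>L real) \<Rightarrow> 'e \<Rightarrow>\<^sub>L real" where
  "cotangent_map M N f p \<alpha> = \<alpha> o\<^sub>L tangent_map M N f p"

definition differential ::
  "('m, 'e::real_normed_vector) manifold_data \<Rightarrow> ('m \<Rightarrow> real) \<Rightarrow> 'm \<Rightarrow> 'e \<Rightarrow>\<^sub>L real" where
  "differential M f p = tangent_map M vs_manifold f p"

definition transpose_map ::
  "('a::real_normed_vector \<Rightarrow> 'b::real_normed_vector) \<Rightarrow> ('b \<Rightarrow>\<^sub>L real) \<Rightarrow> 'a \<Rightarrow>\<^sub>L real" where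
  "transpose_map f \<alpha> = \<alpha> o\<^sub>L Blinfun f"

text \<open>A vector field \<open>X\<close> is given by its values \<open>X q\<close> in the tangent spaces at \<open>q\<close>, hence each
  value refers to a different chart; \<open>local_rep M p X\<close> is its coordinate expression in the
  single chart \<open>chart_at M p\<close>.\<close>

definition local_rep ::
  "('m, 'e::real_normed_vector) manifold_data \<Rightarrow> 'm \<Rightarrow> ('m \<Rightarrow> 'e) \<Rightarrow> 'e \<Rightarrow> 'e" where
  "local_rep M p X x = (let q = chart_inv (chart_at M p) x
     in blinfun_apply (tangent_map M vs_manifold (snd (chart_at M p)) q) (X q))"

text \<open>The Lie bracket of vector fields with \<open>[X, Y] f = X (Y f) - Y (X f)\<close>, in coordinates.\<close>

definition vector_field_bracket ::
  "('m, 'e::real_normed_vector) manifold_data \<Rightarrow> ('m \<Rightarrow> 'e) \<Rightarrow> ('m \<Rightarrow> 'e) \<Rightarrow> 'm \<Rightarrow> 'e" where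
  "vector_field_bracket M X Y p =
     (let x = snd (chart_at M p) p; X' = local_rep M p X; Y' = local_rep M p Y
      in frechet_derivative Y' (at x) (X' x) - frechet_derivative X' (at x) (Y' x))"

section \<open>Lie groups and trivialized Euler-Lagrange equations\<close>

record ('g, 'e) lie_group_data =
  mfd :: "('g, 'e) manifold_data"
  mult :: "'g \<Rightarrow> 'g \<Rightarrow> 'g"
  unit :: 'g

definition lie_group ::
  "('g::{t2_space,second_countable_topology}, 'e::real_normed_vector) lie_group_data \<Rightarrow> bool" where
  "lie_group G \<longleftrightarrow> smooth_manifold (mfd G) \<and>
     smooth_map (prod_manifold (mfd G) (mfd G)) (mfd G) (\<lambda>(g, h). mult G g h) \<and>
     (\<exists>i. group (mult G) (unit G) i \<and> smooth_map (mfd G) (mfd G) i)"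

definition left_invariant_field ::
  "('g, 'e::real_normed_vector) lie_group_data \<Rightarrow> 'e \<Rightarrow> 'g \<Rightarrow> 'e" where
  "left_invariant_field G \<xi> g = blinfun_apply (tangent_map (mfd G) (mfd G) (mult G g) (unit G)) \<xi>"

definition lie_bracket :: "('g, 'e::real_normed_vector) lie_group_data \<Rightarrow> 'e \<Rightarrow> 'e \<Rightarrow> 'e" where
  "lie_bracket G \<xi> \<zeta> = vector_field_bracket (mfd G)
     (left_invariant_field G \<xi>) (left_invariant_field G \<zeta>) (unit G)"

definition coad ::
  "('g, 'e::real_normed_vector) lie_group_data \<Rightarrow> 'e \<Rightarrow> ('e \<Rightarrow>\<^sub>L real) \<Rightarrow> 'e \<Rightarrow>\<^sub>L real" where
  "coad G \<xi> \<mu> = - transpose_map (lie_bracket G \<xi>) \<mu>"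

text \<open>The trivialized Euler-Lagrange equation of \<open>L\<close> at time \<open>t\<close>, along a curve
  \<open>s \<mapsto> (g s, \<xi> s)\<close> in the left-trivialized tangent bundle.\<close>

definition euler_lagrange_at ::
  "('g, 'e::real_normed_vector) lie_group_data \<Rightarrow> ('g \<Rightarrow> 'e \<Rightarrow> real) \<Rightarrow>
   (real \<Rightarrow> 'g) \<Rightarrow> (real \<Rightarrow> 'e) \<Rightarrow> real \<Rightarrow> bool" where
  "euler_lagrange_at G L g \<xi> t \<longleftrightarrow>
     (let dL_dxi = (\<lambda>s. differential vs_manifold (\<lambda>\<zeta>. L (g s) \<zeta>) (\<xi> s));
          dL_dg = (\<lambda>s. differential (mfd G) (\<lambda>k. L k (\<xi> s)) (g s))
      in (dL_dxi has_vector_derivative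
            cotangent_map (mfd G) (mfd G) (mult G (g t)) (unit G) (dL_dg t)
            - coad G (\<xi> t) (dL_dxi t)) (at t))"

section \<open>Cocycle matched pairs\<close>

text \<open>\<open>base\<close> is the distinguished point of \<open>M\<close>, \<open>act h m\<close> is the action of \<open>H\<close> on \<open>M\<close>, and
  \<open>dot m n\<close> is the map \<open>\<Phi>\<close>.\<close>

record ('m, 'e, 'h, 'f) matched_pair_data =
  MM :: "('m, 'e) manifold_data"
  HH :: "('h, 'f) lie_group_data"
  base :: 'm
  act :: "'h \<Rightarrow> 'm \<Rightarrow> 'm"
  sig :: "'h \<Rightarrow> 'm \<Rightarrow> 'h"
  dot :: "'m \<Rightarrow> 'm \<Rightarrow> 'm"
  gam :: "'m \<Rightarrow> 'm \<Rightarrow> 'h"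

definition cocycle_matched_pair ::
  "('m::{t2_space,second_countable_topology}, 'e::real_normed_vector,
    'h::{t2_space,second_countable_topology}, 'f::real_normed_vector) matched_pair_data \<Rightarrow> bool" where
  "cocycle_matched_pair P \<longleftrightarrow>
    (let M = MM P; H = mfd (HH P); mul = mult (HH P); e = unit (HH P); b = base P;
         a = act P; \<sigma> = sig P; d = dot P; \<gamma> = gam P
     in smooth_manifold M \<and> lie_group (HH P) \<and>
        smooth_map (prod_manifold H M) M (\<lambda>(h, m). a h m) \<and>
        (\<forall>m. a e m = m) \<and> (\<forall>h1 h2 m. a (mul h1 h2) m = a h1 (a h2 m)) \<and>
        (\<forall>h. a h b = b) \<and>
        smooth_map (prod_manifold H M) H (\<lambda>(h, m). \<sigma> h m) \<and>
        smooth_map (prod_manifold M M) M (\<lambda>(m, n). d m n) \<and>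
        smooth_map (prod_manifold M M) H (\<lambda>(m, n). \<gamma> m n) \<and>
        (\<forall>h. \<sigma> h b = h) \<and> (\<forall>m. \<sigma> e m = e) \<and> \<gamma> b b = e \<and>
        (\<forall>m. d b m = m \<and> d m b = m) \<and>
        (\<forall>m. \<gamma> m b = e \<and> \<gamma> b m = e) \<and>
        (\<forall>h m1 m2. a h (d m1 m2) = d (a h m1) (a (\<sigma> h m1) m2)) \<and>
        (\<forall>h m1 m2. mul (\<sigma> h (d m1 m2)) (\<gamma> m1 m2)
           = mul (\<gamma> (a h m1) (a (\<sigma> h m1) m2)) (\<sigma> (\<sigma> h m1) m2)) \<and>
        (\<forall>h1 h2 m. \<sigma> (mul h1 h2) m = mul (\<sigma> h1 (a h2 m)) (\<sigma> h2 m)) \<and>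
        (\<forall>m1 m2 m3. d m1 (d m2 m3) = d (d m1 m2) (a (\<gamma> m1 m2) m3)) \<and>
        (\<forall>m1 m2 m3. mul (\<gamma> m1 (d m2 m3)) (\<gamma> m2 m3)
           = mul (\<gamma> (d m1 m2) (a (\<gamma> m1 m2) m3)) (\<sigma> (\<gamma> m1 m2) m3)) \<and>
        (\<forall>m. \<exists>mr. d m mr = b))"

definition cocycle_dcp ::
  "('m, 'e, 'h, 'f) matched_pair_data \<Rightarrow> ('m \<times> 'h, 'e \<times> 'f) lie_group_data" where
  "cocycle_dcp P = \<lparr>mfd = prod_manifold (MM P) (mfd (HH P)),
     mult = (\<lambda>(m1, h1) (m2, h2).
       (dot P m1 (act P h1 m2),
        mult (HH P) (mult (HH P) (gam P m1 (act P h1 m2)) (sig P h1 m2)) h2)),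
     unit = (base P, unit (HH P))\<rparr>"

text \<open>The components of the Lie bracket of the double cross product. Here \<open>'e\<close> is the tangent
  space of \<open>M\<close> at the base point and \<open>'f\<close> the Lie algebra of \<open>H\<close>.\<close>

definition lact :: "('m, 'e::real_normed_vector, 'h, 'f::real_normed_vector) matched_pair_data \<Rightarrow> 'f \<Rightarrow> 'e \<Rightarrow> 'e" where
  "lact P \<eta> v = fst (lie_bracket (cocycle_dcp P) (0, \<eta>) (v, 0))"

definition psi :: "('m, 'e::real_normed_vector, 'h, 'f::real_normed_vector) matched_pair_data \<Rightarrow> 'f \<Rightarrow> 'e \<Rightarrow> 'f" where
  "psi P \<eta> v = snd (lie_bracket (cocycle_dcp P) (0, \<eta>) (v, 0))"

definition dbracket :: "('m, 'e::real_normed_vector, 'h, 'f::real_normed_vector) matched_pair_data \<Rightarrow> 'e \<Rightarrow> 'e \<Rightarrow> 'e" where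
  "dbracket P v1 v2 = fst (lie_bracket (cocycle_dcp P) (v1, 0) (v2, 0))"

definition theta :: "('m, 'e::real_normed_vector, 'h, 'f::real_normed_vector) matched_pair_data \<Rightarrow> 'e \<Rightarrow> 'e \<Rightarrow> 'f" where
  "theta P v1 v2 = snd (lie_bracket (cocycle_dcp P) (v1, 0) (v2, 0))"

text \<open>The right actions of \<open>H\<close> and of its Lie algebra on covectors at the base point.\<close>

definition coact_grp ::
  "('m, 'e::real_normed_vector, 'h, 'f) matched_pair_data \<Rightarrow> ('e \<Rightarrow>\<^sub>L real) \<Rightarrow> 'h \<Rightarrow> 'e \<Rightarrow>\<^sub>L real" where
  "coact_grp P \<alpha> h = cotangent_map (MM P) (MM P) (act P h) (base P) \<alpha>"

definition coact_alg ::
  "('m, 'e::real_normed_vector, 'h, 'f::real_normed_vector) matched_pair_data \<Rightarrow> ('e \<Rightarrow>\<^sub>L real) \<Rightarrow> 'f \<Rightarrow> 'e \<Rightarrow>\<^sub>L real" where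
  "coact_alg P \<alpha> \<eta> = transpose_map (\<lambda>w. lact P \<eta> w) \<alpha>"

definition a_star ::
  "('m, 'e::real_normed_vector, 'h, 'f::real_normed_vector) matched_pair_data \<Rightarrow> 'f \<Rightarrow> ('f \<Rightarrow>\<^sub>L real) \<Rightarrow> 'e \<Rightarrow>\<^sub>L real" where
  "a_star P \<eta> = transpose_map (\<lambda>v. psi P \<eta> v)"

definition b_star ::
  "('m, 'e::real_normed_vector, 'h, 'f::real_normed_vector) matched_pair_data \<Rightarrow> 'e \<Rightarrow> ('e \<Rightarrow>\<^sub>L real) \<Rightarrow> 'f \<Rightarrow>\<^sub>L real" where
  "b_star P v = transpose_map (\<lambda>\<eta>. lact P \<eta> v)"

definition psi_star ::
  "('m, 'e::real_normed_vector, 'h, 'f::real_normed_vector) matched_pair_data \<Rightarrow> 'e \<Rightarrow> ('f \<Rightarrow>\<^sub>L real) \<Rightarrow> 'f \<Rightarrow>\<^sub>L real" where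
  "psi_star P v = transpose_map (\<lambda>\<eta>. psi P \<eta> v)"

definition theta_star ::
  "('m, 'e::real_normed_vector, 'h, 'f::real_normed_vector) matched_pair_data \<Rightarrow> 'e \<Rightarrow> ('f \<Rightarrow>\<^sub>L real) \<Rightarrow> 'e \<Rightarrow>\<^sub>L real" where
  "theta_star P v = transpose_map (\<lambda>w. theta P v w)"

text \<open>\<open>dbracket\<close> need not be a Lie bracket, so this is not an instance of \<open>coad\<close>; the sign
  convention is the same.\<close>

definition d_coad ::
  "('m, 'e::real_normed_vector, 'h, 'f::real_normed_vector) matched_pair_data \<Rightarrow> 'e \<Rightarrow> ('e \<Rightarrow>\<^sub>L real) \<Rightarrow> 'e \<Rightarrow>\<^sub>L real" where
  "d_coad P v \<alpha> = - transpose_map (\<lambda>w. dbracket P v w) \<alpha>"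

end

theory Submission
  imports Defs
begin

text \<open>The Euler-Lagrange equation on \<open>G = M \<bowtie>\<^sub>\<gamma> H\<close> equates the time derivative of a curve in the dual
  of \<open>T\<^sub>oM \<times> \<hh>\<close> with a covector. Such an equation holds if and only if it holds after restriction to
  each of the two factors (\<open>has_vector_derivative_dual_prod_iff\<close>), and the two restrictions are the two
  equations of the theorem. It remains to evaluate the covector on \<open>(w, \<zeta>)\<close>.

  Its first part is the differential of the Lagrangian along the tangent map of the left translation
  by \<open>(m, h)\<close> at the unit. As \<open>\<gamma>(m, o) = 1\<close> and \<open>\<sigma>(h, o) = h\<close>, the chain and product rules give
  (\<open>tangent_map_mult_dcp\<close>)
  \<open>(w, \<zeta>) \<mapsto> (TL\<^sub>m (h \<triangleright> w), T(R\<^sub>h \<circ> \<gamma>\<^sub>m) (h \<triangleright> w) + T\<sigma>\<^sub>h w + TL\<^sub>h \<zeta>)\<close>,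
  with \<open>L\<^sub>m n = m \<cdot> n\<close>,
  and the transposes of the entries are the four terms in \<open>\<delta>L/\<delta>m\<close> and \<open>\<delta>L/\<delta>h\<close>. The second part is
  \<open>\<delta>L/\<delta>\<xi>\<close> applied to \<open>[(v, \<eta>), (w, \<zeta>)]\<close>, and \<open>lie_bracket_dcp\<close> expands this bracket by bilinearity.
  The only bracket not given by the definition of the component maps is
  \<open>[(0, \<eta>), (0, \<zeta>)] = (0, [\<eta>, \<zeta>])\<close>: the left invariant fields generated by \<open>\<hh>\<close> are those of \<open>H\<close>,
  extended constantly along \<open>M\<close> (\<open>lie_bracket_vertical\<close>).

  Bilinearity of the bracket is not automatic for a bracket defined by coordinate expressions of left
  invariant fields: these have to be differentiable. In coordinates such a field is a partial
  derivative of the product (\<open>left_invariant_field_local_rep\<close>), so this follows from the smoothness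
  of the product on \<open>G\<close>, which in turn needs that compositions of smooth maps are smooth. Transposes
  require moreover that the bracket is bounded, which holds by finite dimensionality.\<close>

section \<open>Finite-dimensional normed spaces\<close>

text \<open>Equivalence of norms in finite dimension, for a model space that carries no canonical basis.
  The coefficient vectors of supremum norm 1 form a compact set by Tychonoff's theorem, applied to
  functions that may be nonzero outside \<open>B\<close>, and the norm of the linear combination attains a
  positive minimum on it by independence.\<close>

lemma finite_basis_coordinates_bound:
  fixes B :: "'a::real_normed_vector set"
  assumes "finite B" and "independent B"
  obtains \<delta> where "\<delta> > 0"
    and "\<And>a b. b \<in> B \<Longrightarrow> \<delta> * \<bar>a b\<bar> \<le> norm (\<Sum>b\<in>B. a b *\<^sub>R b)"
proof (cases "B = {}")
  case True
  then show ?thesis using that[of 1] by auto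
next
  case False
  define N where "N a = norm (\<Sum>b\<in>B. a b *\<^sub>R b)" for a :: "'a \<Rightarrow> real"
  define K :: "('a \<Rightarrow> real) set" where "K = PiE UNIV (\<lambda>_. {-1..1}) \<inter> (\<Union>b\<in>B. {a. \<bar>a b\<bar> = 1})"
  have "compact (PiE UNIV (\<lambda>_::'a. {-1..1::real}))"
    using compactin_PiE[of "\<lambda>_::'a. euclidean :: real topology" UNIV "\<lambda>_. {-1..1}"]
    by (simp add: euclidean_product_topology compactin_euclidean_iff)
  moreover have "closed (\<Union>b\<in>B. {a::'a \<Rightarrow> real. \<bar>a b\<bar> = 1})"
  proof (intro closed_UN assms(1) ballI)
    fix b :: 'a
    show "closed {a::'a \<Rightarrow> real. \<bar>a b\<bar> = 1}"
      by (intro closed_Collect_eq continuous_intros continuous_on_product_coordinates)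
  qed
  ultimately have K: "compact K"
    unfolding K_def by (rule compact_Int_closed)
  have N: "continuous_on K N"
    unfolding N_def
    by (intro continuous_intros continuous_on_subset[OF continuous_on_product_coordinates subset_UNIV])
  have "K \<noteq> {}"
  proof -
    have "(\<lambda>_. 1) \<in> K" using False by (auto simp: K_def)
    then show ?thesis by blast
  qed
  then obtain a0 where a0: "a0 \<in> K" "\<And>a. a \<in> K \<Longrightarrow> N a0 \<le> N a"
    using continuous_attains_inf[OF K _ N] by blast
  have "N a0 \<noteq> 0"
  proof
    assume "N a0 = 0"
    then have "(\<Sum>b\<in>B. a0 b *\<^sub>R b) = 0" by (simp add: N_def)
    then have "\<forall>b\<in>B. a0 b = 0" using assms independentD by blast
    then show False using a0(1) by (auto simp: K_def)
  qed
  then have pos: "N a0 > 0" by (simp add: N_def)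
  show ?thesis
  proof (rule that[OF pos])
    fix a :: "'a \<Rightarrow> real" and b assume b: "b \<in> B"
    define s where "s = Max ((\<lambda>b. \<bar>a b\<bar>) ` B)"
    have le: "\<bar>a c\<bar> \<le> s" if "c \<in> B" for c
      using that assms(1) by (simp add: s_def)
    have "s \<in> (\<lambda>b. \<bar>a b\<bar>) ` B"
      unfolding s_def using False assms(1) by (intro Max_in) auto
    then obtain c where c: "c \<in> B" "\<bar>a c\<bar> = s" by auto
    show "N a0 * \<bar>a b\<bar> \<le> norm (\<Sum>b\<in>B. a b *\<^sub>R b)"
    proof (cases "s = 0")
      case True
      then show ?thesis using le[OF b] by simp
    next
      case False
      then have s: "s > 0" using le[OF b] by linarith
      define a' where "a' c = (if c \<in> B then a c / s else 0)" for c
      have "a' \<in> K"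
        using le s c
        by (auto simp: K_def a'_def abs_le_iff divide_le_eq le_divide_eq minus_le_iff intro!: bexI[of _ c])
      then have "N a0 \<le> N a'" by (rule a0)
      also have "N a' = N a / s"
      proof -
        have "(\<Sum>b\<in>B. a' b *\<^sub>R b) = (1/s) *\<^sub>R (\<Sum>b\<in>B. a b *\<^sub>R b)"
          unfolding scaleR_sum_right by (rule sum.cong) (auto simp: a'_def divide_inverse mult.commute)
        then show ?thesis using s by (simp add: N_def)
      qed
      finally have "N a0 * s \<le> N a" using s by (simp add: field_simps)
      moreover have "N a0 * \<bar>a b\<bar> \<le> N a0 * s" using le[OF b] pos by simp
      ultimately show ?thesis by (simp add: N_def)
    qed
  qed
qed

text \<open>The bounded coordinate functionals have two uses: they make every linear map bounded, and
  they allow the chain rule to be iterated with derivatives in fixed directions only.\<close>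

lemma finite_span_coordinates:
  fixes B :: "'a::real_normed_vector set"
  assumes "finite B" and "span B = UNIV"
  obtains B' and c :: "'a \<Rightarrow> 'a \<Rightarrow> real" where "finite B'"
    and "\<And>b. bounded_linear (c b)" and "\<And>x. x = (\<Sum>b\<in>B'. c b x *\<^sub>R b)"
proof -
  obtain B' where B': "B' \<subseteq> B" "independent B'" "span B' = UNIV"
    using maximal_independent_subset[of B] assms(2)
    by (metis span_mono span_span top.extremum_unique)
  have fin: "finite B'" using B'(1) assms(1) finite_subset by blast
  define c where "c b x = representation B' x b" for b x
  have sum: "x = (\<Sum>b\<in>B'. c b x *\<^sub>R b)" for x
    using real_vector.sum_representation_eq[OF B'(2) _ fin order_refl, of x] B'(3) by (simp add: c_def)
  obtain \<delta> where \<delta>: "\<delta> > 0"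
    "\<And>a b. b \<in> B' \<Longrightarrow> \<delta> * \<bar>a b\<bar> \<le> norm (\<Sum>b\<in>B'. a b *\<^sub>R b)"
    using finite_basis_coordinates_bound[OF fin B'(2)] by blast
  have "bounded_linear (c b)" for b
  proof (rule bounded_linear_intro[of _ "1 / \<delta>"])
    show "c b (x + y) = c b x + c b y" for x y
      using B'(3) real_vector.representation_add[OF B'(2), of y x] by (simp add: c_def)
    show "c b (r *\<^sub>R x) = r *\<^sub>R c b x" for r x
      using B'(3) real_vector.representation_scale[OF B'(2), of x r] by (simp add: c_def)
    show "norm (c b x) \<le> norm x * (1 / \<delta>)" for x
    proof (cases "b \<in> B'")
      case True
      have "\<delta> * \<bar>c b x\<bar> \<le> norm x"
        using \<delta>(2)[OF True, of "\<lambda>b. c b x"] sum[of x] by simp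
      then show ?thesis using \<delta>(1) by (simp add: field_simps)
    next
      case False
      then have "c b x = 0"
        using real_vector.representation_ne_zero by (force simp: c_def)
      then show ?thesis using \<delta>(1) by simp
    qed
  qed
  then show ?thesis using that fin sum by blast
qed

lemma linear_imp_bounded_linear_finite_span:
  fixes f :: "'a::real_normed_vector \<Rightarrow> 'b::real_normed_vector"
  assumes "finite (B :: 'a set)" and "span B = UNIV" and "linear f"
  shows "bounded_linear f"
proof -
  obtain B' and c :: "'a \<Rightarrow> 'a \<Rightarrow> real" where c: "finite B'"
    "\<And>b. bounded_linear (c b)" "\<And>x. x = (\<Sum>b\<in>B'. c b x *\<^sub>R b)"
    using finite_span_coordinates[OF assms(1,2)] by blast
  have "f = (\<lambda>x. \<Sum>b\<in>B'. c b x *\<^sub>R f b)"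
  proof
    fix x
    have "f x = f (\<Sum>b\<in>B'. c b x *\<^sub>R b)" using c(3)[of x] by simp
    also have "\<dots> = (\<Sum>b\<in>B'. c b x *\<^sub>R f b)"
      by (simp add: linear_sum[OF assms(3)] linear_cmul[OF assms(3)])
    finally show "f x = (\<Sum>b\<in>B'. c b x *\<^sub>R f b)" .
  qed
  moreover have "bounded_linear (\<lambda>x. \<Sum>b\<in>B'. c b x *\<^sub>R f b)"
    by (intro bounded_linear_sum bounded_linear_scaleR_const c(2))
  ultimately show ?thesis by simp
qed

lemma finite_span_Times:
  assumes "\<exists>B :: 'a::real_normed_vector set. finite B \<and> span B = UNIV"
    and "\<exists>B :: 'b::real_normed_vector set. finite B \<and> span B = UNIV"
  shows "\<exists>B :: ('a \<times> 'b) set. finite B \<and> span B = UNIV"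
proof -
  obtain A :: "'a set" and B :: "'b set" where AB: "finite A" "span A = UNIV" "finite B" "span B = UNIV"
    using assms by blast
  let ?C = "(\<lambda>a. (a, 0)) ` A \<union> (\<lambda>b. (0, b)) ` B"
  have l: "linear (\<lambda>a::'a. (a, 0::'b))" "linear (\<lambda>b::'b. (0::'a, b))"
    by (auto intro!: linearI)
  have "(x, y) \<in> span ?C" for x y
  proof -
    have "(x, 0::'b) \<in> span ((\<lambda>a. (a, 0)) ` A)" "(0::'a, y) \<in> span ((\<lambda>b. (0, b)) ` B)"
      using AB by (auto simp: linear_span_image[OF l(1)] linear_span_image[OF l(2)])
    then have "(x, 0) \<in> span ?C" "(0, y) \<in> span ?C"
      by (meson span_mono subsetD sup_ge1 sup_ge2)+
    from span_add[OF this] show ?thesis by simp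
  qed
  then have "finite ?C \<and> span ?C = UNIV" using AB by auto
  then show ?thesis by blast
qed

section \<open>Calculus of smooth maps between normed spaces\<close>

lemma C_n_on_subset: "C_n_on n S f \<Longrightarrow> T \<subseteq> S \<Longrightarrow> C_n_on n T f"
  by (induction n arbitrary: f) (auto intro: continuous_on_subset)

lemma C_n_on_cong:
  assumes "open S" and "\<And>x. x \<in> S \<Longrightarrow> f x = g x" and "C_n_on n S f"
  shows "C_n_on n S g"
  using assms(2,3)
proof (induction n arbitrary: f g)
  case 0
  then show ?case by (metis C_n_on.simps(1) continuous_on_cong)
next
  case (Suc n)
  have d: "f differentiable (at x)" if "x \<in> S" for x using Suc.prems that by simp
  have dg: "g differentiable (at x)" if "x \<in> S" for x
    using d[OF that] that Suc.prems(1) assms(1)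
    unfolding differentiable_def by (blast intro: has_derivative_transform_within_open)
  have eq: "frechet_derivative f (at x) = frechet_derivative g (at x)" if "x \<in> S" for x
    by (rule frechet_derivative_transform_within_open[OF d assms(1)]) (use that Suc.prems in auto)
  have "C_n_on n S (\<lambda>x. frechet_derivative g (at x) w)" for w
    by (rule Suc.IH[of "\<lambda>x. frechet_derivative f (at x) w"]) (use eq Suc.prems in auto)
  then show ?case using dg by simp
qed

lemma C_n_on_SucD: "C_n_on (Suc n) S f \<Longrightarrow> C_n_on n S f"
proof (induction n arbitrary: f)
  case 0
  then show ?case
    by (auto intro!: continuous_at_imp_continuous_on differentiable_imp_continuous_within)
next
  case (Suc n)
  then show ?case by (metis C_n_on.simps(2))
qed

lemma C_n_on_SucI:
  assumes "open S" and "\<And>x. x \<in> S \<Longrightarrow> (f has_derivative f' x) (at x)"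
    and "\<And>w. C_n_on n S (\<lambda>x. f' x w)"
  shows "C_n_on (Suc n) S f"
proof -
  have "frechet_derivative f (at x) = f' x" if "x \<in> S" for x
    using frechet_derivative_at[OF assms(2)[OF that]] by simp
  then have "C_n_on n S (\<lambda>x. frechet_derivative f (at x) w)" for w
    using C_n_on_cong[OF assms(1) _ assms(3)[of w]] by simp
  then show ?thesis using assms(2) by (auto simp: differentiable_def)
qed

lemma C_n_on_SucE:
  assumes "C_n_on (Suc n) S f"
  shows "x \<in> S \<Longrightarrow> (f has_derivative frechet_derivative f (at x)) (at x)"
    and "C_n_on n S (\<lambda>x. frechet_derivative f (at x) w)"
  using assms by (auto simp: frechet_derivative_works)

lemma C_n_on_const: "open S \<Longrightarrow> C_n_on n S (\<lambda>x. c)"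
  by (induction n arbitrary: c) (auto intro!: C_n_on_SucI derivative_eq_intros simp del: C_n_on.simps(2))

lemma C_n_on_bounded_linear:
  assumes "open S" and "bounded_linear l"
  shows "C_n_on n S l"
proof (cases n)
  case 0
  then show ?thesis using assms by (simp add: linear_continuous_on)
next
  case (Suc k)
  show ?thesis unfolding Suc
    using assms by (intro C_n_on_SucI[where f' = "\<lambda>_. l"] C_n_on_const bounded_linear_imp_has_derivative)
qed

lemma C_n_on_bounded_linear_comp:
  assumes "open S" and l: "bounded_linear l" and "C_n_on n S f"
  shows "C_n_on n S (\<lambda>x. l (f x))"
  using assms(3)
proof (induction n arbitrary: f)
  case 0
  then show ?case using l by (auto intro: bounded_linear.continuous_on)
next
  case (Suc n)
  note f = C_n_on_SucE[OF Suc.prems]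
  show ?case
    by (rule C_n_on_SucI[where f' = "\<lambda>x w. l (frechet_derivative f (at x) w)"])
      (intro assms(1) bounded_linear.has_derivative[OF l] Suc.IH f | assumption)+
qed

lemma C_n_on_add:
  assumes "open S" and "C_n_on n S f" and "C_n_on n S g"
  shows "C_n_on n S (\<lambda>x. f x + g x)"
  using assms(2,3)
proof (induction n arbitrary: f g)
  case 0
  then show ?case by (auto intro: continuous_on_add)
next
  case (Suc n)
  note f = C_n_on_SucE[OF Suc.prems(1)] and g = C_n_on_SucE[OF Suc.prems(2)]
  show ?case
    by (rule C_n_on_SucI[where f' = "\<lambda>x w. frechet_derivative f (at x) w + frechet_derivative g (at x) w"])
      (intro assms(1) has_derivative_add Suc.IH f g | assumption)+
qed

lemma C_n_on_sum:
  assumes "open S" and "finite A" and "\<And>i. i \<in> A \<Longrightarrow> C_n_on n S (f i)"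
  shows "C_n_on n S (\<lambda>x. \<Sum>i\<in>A. f i x)"
  using assms(2,3) by (induction A) (auto intro!: C_n_on_add C_n_on_const assms(1))

lemma C_n_on_scaleR:
  fixes a :: "'a::real_normed_vector \<Rightarrow> real" and f :: "'a \<Rightarrow> 'b::real_normed_vector"
  assumes "open S" and "C_n_on n S a" and "C_n_on n S f"
  shows "C_n_on n S (\<lambda>x. a x *\<^sub>R f x)"
  using assms(2,3)
proof (induction n arbitrary: a f)
  case 0
  then show ?case by (auto intro: continuous_on_scaleR)
next
  case (Suc n)
  note a = C_n_on_SucE[OF Suc.prems(1)] and f = C_n_on_SucE[OF Suc.prems(2)]
  show ?case
  proof (rule C_n_on_SucI[where f' = "\<lambda>x w. a x *\<^sub>R frechet_derivative f (at x) w
      + frechet_derivative a (at x) w *\<^sub>R f x"])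
    show "open S" by fact
    show "((\<lambda>x. a x *\<^sub>R f x) has_derivative (\<lambda>w. a x *\<^sub>R frechet_derivative f (at x) w
      + frechet_derivative a (at x) w *\<^sub>R f x)) (at x)" if "x \<in> S" for x
      using has_derivative_scaleR[OF a(1)[OF that] f(1)[OF that]] .
    show "C_n_on n S (\<lambda>x. a x *\<^sub>R frechet_derivative f (at x) w
      + frechet_derivative a (at x) w *\<^sub>R f x)" for w
      by (intro C_n_on_add Suc.IH assms(1) a f C_n_on_SucD[OF Suc.prems(1)] C_n_on_SucD[OF Suc.prems(2)])
  qed
qed

text \<open>The derivative of a composition applies \<open>Dg\<close> to the moving direction \<open>Df(x) w\<close>, whereas
  the hypotheses on \<open>g\<close> control \<open>Dg\<close> in fixed directions. Expanding the moving direction in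
  coordinates gives a sum of products of a scalar function and a composition of lower order.\<close>

lemma C_n_on_compose:
  fixes f :: "'a::real_normed_vector \<Rightarrow> 'b::real_normed_vector" and g :: "'b \<Rightarrow> 'c::real_normed_vector"
  assumes B: "finite (B :: 'b set)" "span B = UNIV"
    and "open S" and "f ` S \<subseteq> T" and "C_n_on n S f" and "C_n_on n T g"
  shows "C_n_on n S (\<lambda>x. g (f x))"
  using assms(5,6)
proof (induction n arbitrary: g)
  case 0
  then show ?case using assms(4) by (auto intro: continuous_on_compose2)
next
  case (Suc n)
  note f = C_n_on_SucE[OF Suc.prems(1)] and g = C_n_on_SucE[OF Suc.prems(2)]
  obtain B' and c :: "'b \<Rightarrow> 'b \<Rightarrow> real" where c: "finite B'"
    "\<And>b. bounded_linear (c b)" "\<And>x. x = (\<Sum>b\<in>B'. c b x *\<^sub>R b)"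
    using finite_span_coordinates[OF B] by blast
  show ?case
  proof (rule C_n_on_SucI[where f' = "\<lambda>x w. \<Sum>b\<in>B'.
      c b (frechet_derivative f (at x) w) *\<^sub>R frechet_derivative g (at (f x)) b"])
    show "open S" by fact
    show "((\<lambda>x. g (f x)) has_derivative (\<lambda>w. \<Sum>b\<in>B'.
      c b (frechet_derivative f (at x) w) *\<^sub>R frechet_derivative g (at (f x)) b)) (at x)"
      if x: "x \<in> S" for x
    proof -
      have gd: "(g has_derivative frechet_derivative g (at (f x))) (at (f x))"
        using g(1) x assms(4) by blast
      then have lin: "linear (frechet_derivative g (at (f x)))"
        by (rule has_derivative_linear)
      have expand: "frechet_derivative g (at (f x)) u
          = (\<Sum>b\<in>B'. c b u *\<^sub>R frechet_derivative g (at (f x)) b)" for u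
      proof -
        have "frechet_derivative g (at (f x)) u
            = frechet_derivative g (at (f x)) (\<Sum>b\<in>B'. c b u *\<^sub>R b)"
          using c(3)[of u] by simp
        also have "\<dots> = (\<Sum>b\<in>B'. c b u *\<^sub>R frechet_derivative g (at (f x)) b)"
          by (simp only: linear_sum[OF lin] linear_cmul[OF lin])
        finally show ?thesis .
      qed
      have "((\<lambda>x. g (f x)) has_derivative
          (\<lambda>w. frechet_derivative g (at (f x)) (frechet_derivative f (at x) w))) (at x)"
        using diff_chain_at[OF f(1)[OF x] gd] unfolding o_def .
      moreover have "(\<lambda>w. frechet_derivative g (at (f x)) (frechet_derivative f (at x) w)) =
          (\<lambda>w. \<Sum>b\<in>B'. c b (frechet_derivative f (at x) w) *\<^sub>R frechet_derivative g (at (f x)) b)"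
        by (rule ext) (rule expand)
      ultimately show ?thesis by (simp only:)
    qed
    show "C_n_on n S (\<lambda>x. \<Sum>b\<in>B'.
      c b (frechet_derivative f (at x) w) *\<^sub>R frechet_derivative g (at (f x)) b)" for w
    proof (rule C_n_on_sum[OF assms(3) c(1)], rule C_n_on_scaleR[OF assms(3)])
      show "C_n_on n S (\<lambda>x. c b (frechet_derivative f (at x) w))" for b
        by (rule C_n_on_bounded_linear_comp[OF assms(3) c(2) f(2)])
      show "C_n_on n S (\<lambda>x. frechet_derivative g (at (f x)) b)" for b
        by (rule Suc.IH[OF C_n_on_SucD[OF Suc.prems(1)] g(2)])
    qed
  qed
qed

lemma smooth_on_subset: "smooth_on S f \<Longrightarrow> T \<subseteq> S \<Longrightarrow> smooth_on T f"
  unfolding smooth_on_def using C_n_on_subset by blast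

lemma smooth_on_cong: "open S \<Longrightarrow> (\<And>x. x \<in> S \<Longrightarrow> f x = g x) \<Longrightarrow> smooth_on S f \<Longrightarrow> smooth_on S g"
  unfolding smooth_on_def using C_n_on_cong by blast

lemma smooth_on_const: "open S \<Longrightarrow> smooth_on S (\<lambda>x. c)"
  unfolding smooth_on_def using C_n_on_const by blast

lemma smooth_on_bounded_linear: "open S \<Longrightarrow> bounded_linear l \<Longrightarrow> smooth_on S l"
  unfolding smooth_on_def using C_n_on_bounded_linear by blast

lemma smooth_on_Pair:
  fixes f :: "'a::real_normed_vector \<Rightarrow> 'b::real_normed_vector" and g :: "'a \<Rightarrow> 'c::real_normed_vector"
  assumes "open S" and "smooth_on S f" and "smooth_on S g"
  shows "smooth_on S (\<lambda>x. (f x, g x))"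
  unfolding smooth_on_def
proof
  fix n
  have "bounded_linear (\<lambda>x::'b. (x, 0::'c))" "bounded_linear (\<lambda>y::'c. (0::'b, y))"
    by (auto intro!: bounded_linear_Pair bounded_linear_ident bounded_linear_zero)
  with assms have "C_n_on n S (\<lambda>x. (f x, 0) + (0, g x))"
    unfolding smooth_on_def by (intro C_n_on_add assms(1)) (auto intro: C_n_on_bounded_linear_comp)
  then show "C_n_on n S (\<lambda>x. (f x, g x))" by simp
qed

lemma smooth_on_compose:
  fixes f :: "'a::real_normed_vector \<Rightarrow> 'b::real_normed_vector" and g :: "'b \<Rightarrow> 'c::real_normed_vector"
  assumes "\<exists>B :: 'b set. finite B \<and> span B = UNIV"
    and "open S" and "f ` S \<subseteq> T" and "smooth_on S f" and "smooth_on T g"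
  shows "smooth_on S (\<lambda>x. g (f x))"
  using assms C_n_on_compose unfolding smooth_on_def by metis

lemma smooth_on_imp_continuous_on: "smooth_on S f \<Longrightarrow> continuous_on S f"
  unfolding smooth_on_def by (metis C_n_on.simps(1))

lemma smooth_on_has_derivative:
  "smooth_on S f \<Longrightarrow> x \<in> S \<Longrightarrow> (f has_derivative frechet_derivative f (at x)) (at x)"
  unfolding smooth_on_def using C_n_on_SucE(1) by blast

lemma smooth_on_frechet_derivative: "smooth_on S f \<Longrightarrow> smooth_on S (\<lambda>x. frechet_derivative f (at x) w)"
  unfolding smooth_on_def using C_n_on_SucE(2) by blast

section \<open>Smooth structures and preferred charts\<close>

text \<open>The chart axioms of \<open>smooth_manifold\<close>, stated over a type of points that is merely a
  topological space. A normed space is a manifold over itself by \<open>vs_manifold\<close>, but its type class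
  does not provide second countability; this form puts it on the same footing as \<open>M\<close> and \<open>H\<close>.\<close>

definition smooth_structure ::
  "('m::topological_space, 'e::real_normed_vector) manifold_data \<Rightarrow> bool" where
  "smooth_structure M \<longleftrightarrow>
     (\<exists>B::'e set. finite B \<and> span B = UNIV) \<and>
     (\<forall>c \<in> atlas M. open (fst c) \<and> open (snd c ` fst c) \<and>
        homeomorphism (fst c) (snd c ` fst c) (snd c) (chart_inv c)) \<and>
     (\<forall>c \<in> atlas M. \<forall>d \<in> atlas M.
        smooth_on (snd c ` (fst c \<inter> fst d)) (\<lambda>x. snd d (chart_inv c x))) \<and>
     (\<forall>p. chart_at M p \<in> atlas M \<and> p \<in> fst (chart_at M p))"

lemma smooth_manifold_imp_smooth_structure: "smooth_manifold M \<Longrightarrow> smooth_structure M"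
  unfolding smooth_manifold_def smooth_structure_def by (fastforce simp: o_def)

lemma smooth_structure_finite_dim:
  "smooth_structure (M :: ('m::topological_space, 'e::real_normed_vector) manifold_data) \<Longrightarrow>
     \<exists>B::'e set. finite B \<and> span B = UNIV"
  by (simp add: smooth_structure_def)

context
  fixes M :: "('m::topological_space, 'e::real_normed_vector) manifold_data" and c
  assumes M: "smooth_structure M" and c: "c \<in> atlas M"
begin

lemma chart_homeomorphism: "homeomorphism (fst c) (snd c ` fst c) (snd c) (chart_inv c)"
  using M c by (simp add: smooth_structure_def)

lemma chart_inv_left: "q \<in> fst c \<Longrightarrow> chart_inv c (snd c q) = q"
  using chart_homeomorphism by (simp add: homeomorphism_def)

lemma chart_inv_right: "x \<in> snd c ` fst c \<Longrightarrow> snd c (chart_inv c x) = x"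
  using chart_homeomorphism unfolding homeomorphism_def by blast

lemma chart_inv_in: "x \<in> snd c ` fst c \<Longrightarrow> chart_inv c x \<in> fst c"
  using chart_inv_left by auto

lemma open_chart_image: "open W \<Longrightarrow> open (snd c ` (fst c \<inter> W))"
proof -
  assume "open W"
  then have "openin (top_of_set (fst c)) (fst c \<inter> W)" by (rule openin_open_Int)
  then have "openin (top_of_set (snd c ` fst c)) (snd c ` (fst c \<inter> W))"
    by (rule homeomorphism_imp_open_map[OF chart_homeomorphism])
  moreover have "open (snd c ` fst c)" using M c by (simp add: smooth_structure_def)
  ultimately show ?thesis by (simp add: openin_open_eq)
qed

end

abbreviation (input) dom_at :: "('m, 'e) manifold_data \<Rightarrow> 'm \<Rightarrow> 'm set" where
  "dom_at M p \<equiv> fst (chart_at M p)"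

abbreviation (input) coord_at :: "('m, 'e) manifold_data \<Rightarrow> 'm \<Rightarrow> 'm \<Rightarrow> 'e" where
  "coord_at M p \<equiv> snd (chart_at M p)"

abbreviation (input) point_at :: "('m, 'e) manifold_data \<Rightarrow> 'm \<Rightarrow> 'e \<Rightarrow> 'm" where
  "point_at M p \<equiv> chart_inv (chart_at M p)"

context
  fixes M :: "('m::topological_space, 'e::real_normed_vector) manifold_data"
  assumes M: "smooth_structure M"
begin

lemma chart_at_in_atlas: "chart_at M p \<in> atlas M"
  using M by (simp add: smooth_structure_def)

lemma in_dom_at: "p \<in> dom_at M p"
  using M by (simp add: smooth_structure_def)

lemma open_dom_at: "open (dom_at M p)"
  using M chart_at_in_atlas by (simp add: smooth_structure_def)

lemmas point_at_coord_at = chart_inv_left[OF M chart_at_in_atlas]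
lemmas coord_at_point_at = chart_inv_right[OF M chart_at_in_atlas]
lemmas point_at_in = chart_inv_in[OF M chart_at_in_atlas]

lemma open_coord_at_image: "open W \<Longrightarrow> open (coord_at M p ` (dom_at M p \<inter> W))"
  by (rule open_chart_image[OF M chart_at_in_atlas])

lemma open_coord_at_dom: "open (coord_at M p ` dom_at M p)"
  using open_coord_at_image[of UNIV] by simp

end

lemma vs_manifold_simps [simp]:
  "atlas vs_manifold = {(UNIV, id)}" "chart_at vs_manifold p = (UNIV, id)"
  "chart_inv (UNIV, id) = id"
  by (simp_all add: vs_manifold_def chart_inv_def fun_eq_iff)

lemma smooth_structure_vs_manifold:
  assumes "\<exists>B::'e::real_normed_vector set. finite B \<and> span B = UNIV"
  shows "smooth_structure (vs_manifold :: ('e, 'e) manifold_data)"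
  using assms unfolding smooth_structure_def
  by (auto simp: homeomorphism_def intro!: smooth_on_bounded_linear bounded_linear_ident)

lemma prod_manifold_simps [simp]:
  "chart_at (prod_manifold M N) (p, q) = prod_chart (chart_at M p) (chart_at N q)"
  by (simp add: prod_manifold_def)

lemma prod_chart_simps [simp]:
  "fst (prod_chart c d) = fst c \<times> fst d" "snd (prod_chart c d) = map_prod (snd c) (snd d)"
  by (simp_all add: prod_chart_def)

lemma prod_vs_manifold: "prod_manifold vs_manifold vs_manifold = vs_manifold"
proof -
  have "prod_chart (UNIV, id) (UNIV, id) = (UNIV, id)"
    by (simp add: prod_chart_def fun_eq_iff)
  then show ?thesis by (auto simp: vs_manifold_def prod_manifold_def intro!: ext)
qed

text \<open>Both sides involve a choice of preimage, which is arbitrary off the images of the charts.\<close>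

lemma chart_inv_prod_chart:
  assumes "inj_on (snd c) (fst c)" and "inj_on (snd d) (fst d)"
    and "x \<in> snd c ` fst c" and "y \<in> snd d ` fst d"
  shows "chart_inv (prod_chart c d) (x, y) = (chart_inv c x, chart_inv d y)"
proof -
  obtain p q where pq: "p \<in> fst c" "q \<in> fst d" "x = snd c p" "y = snd d q"
    using assms(3,4) by auto
  have "inj_on (map_prod (snd c) (snd d)) (fst c \<times> fst d)"
    using assms(1,2) by (rule map_prod_inj_on)
  from inv_into_f_f[OF this, of "(p, q)"] show ?thesis
    using pq assms(1,2) by (simp add: chart_inv_def)
qed

lemma smooth_structure_prod:
  fixes M :: "('m::topological_space, 'e::real_normed_vector) manifold_data"
    and N :: "('n::topological_space, 'f::real_normed_vector) manifold_data"
  assumes M: "smooth_structure M" and N: "smooth_structure N"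
  shows "smooth_structure (prod_manifold M N)"
proof -
  have inv: "chart_inv (prod_chart c d) (x, y) = (chart_inv c x, chart_inv d y)"
    if "c \<in> atlas M" "d \<in> atlas N" "x \<in> snd c ` fst c" "y \<in> snd d ` fst d" for c d x y
    using that chart_inv_left[OF M that(1)] chart_inv_left[OF N that(2)]
    by (intro chart_inv_prod_chart) (auto intro: inj_on_inverseI)
  have img: "map_prod f g ` (A \<times> B) = f ` A \<times> g ` B" for f :: "'m \<Rightarrow> 'e" and g :: "'n \<Rightarrow> 'f" and A B
    by (rule map_prod_surj_on) simp_all
  have chart: "open (fst e) \<and> open (snd e ` fst e) \<and>
      homeomorphism (fst e) (snd e ` fst e) (snd e) (chart_inv e)"
    if e: "e \<in> atlas (prod_manifold M N)" for e
  proof -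
    obtain c d where cd: "e = prod_chart c d" "c \<in> atlas M" "d \<in> atlas N"
      using e by (auto simp: prod_manifold_def)
    note C = chart_homeomorphism[OF M cd(2)] and D = chart_homeomorphism[OF N cd(3)]
    have o: "open (fst c)" "open (fst d)" "open (snd c ` fst c)" "open (snd d ` fst d)"
      using M N cd by (auto simp: smooth_structure_def)
    have c1: "continuous_on (fst c \<times> fst d) (map_prod (snd c) (snd d))"
      unfolding map_prod_def split_beta
      using C D by (auto simp: homeomorphism_def intro!: continuous_intros elim!: continuous_on_compose2)
    have "continuous_on (snd c ` fst c \<times> snd d ` fst d) (\<lambda>z. (chart_inv c (fst z), chart_inv d (snd z)))"
      using C D by (auto simp: homeomorphism_def intro!: continuous_intros elim!: continuous_on_compose2)
    then have c2: "continuous_on (snd c ` fst c \<times> snd d ` fst d) (chart_inv e)"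
      by (rule continuous_on_eq) (auto simp: cd(1) inv[OF cd(2,3)])
    have "homeomorphism (fst e) (snd e ` fst e) (snd e) (chart_inv e)"
      unfolding homeomorphism_def
    proof (intro conjI ballI)
      show l: "chart_inv e (snd e x) = x" if "x \<in> fst e" for x
        using that chart_inv_left[OF M cd(2)] chart_inv_left[OF N cd(3)]
        by (auto simp: cd(1) inv[OF cd(2,3)])
      show "snd e (chart_inv e y) = y" if "y \<in> snd e ` fst e" for y
        using that l by auto
      show "chart_inv e ` snd e ` fst e = fst e" using l by force
      show "continuous_on (fst e) (snd e)" using c1 by (simp add: cd(1))
      show "continuous_on (snd e ` fst e) (chart_inv e)" using c2 by (simp add: cd(1) img)
    qed simp
    then show ?thesis using o by (simp add: cd(1) img open_Times)
  qed
  have trans: "smooth_on (snd e ` (fst e \<inter> fst e')) (\<lambda>x. snd e' (chart_inv e x))"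
    if e: "e \<in> atlas (prod_manifold M N)" and e': "e' \<in> atlas (prod_manifold M N)" for e e'
  proof -
    obtain c d where cd: "e = prod_chart c d" "c \<in> atlas M" "d \<in> atlas N"
      using e by (auto simp: prod_manifold_def)
    obtain c' d' where cd': "e' = prod_chart c' d'" "c' \<in> atlas M" "d' \<in> atlas N"
      using e' by (auto simp: prod_manifold_def)
    define S T where "S = snd c ` (fst c \<inter> fst c')" and "T = snd d ` (fst d \<inter> fst d')"
    have dom: "snd e ` (fst e \<inter> fst e') = S \<times> T"
      by (simp add: cd(1) cd'(1) Times_Int_Times img S_def T_def)
    have op: "open (S \<times> T)"
      unfolding S_def T_def using M N cd cd'
      by (intro open_Times open_chart_image[OF M] open_chart_image[OF N]) (auto simp: smooth_structure_def)
    have s: "smooth_on S (\<lambda>x. snd c' (chart_inv c x))" "smooth_on T (\<lambda>x. snd d' (chart_inv d x))"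
      using M N cd cd' by (auto simp: smooth_structure_def S_def T_def)
    have "smooth_on (S \<times> T) (\<lambda>z. (snd c' (chart_inv c (fst z)), snd d' (chart_inv d (snd z))))"
      using smooth_structure_finite_dim[OF M] smooth_structure_finite_dim[OF N]
      by (intro smooth_on_Pair op smooth_on_compose[OF _ op _ _ s(1)] smooth_on_compose[OF _ op _ _ s(2)]
          smooth_on_bounded_linear bounded_linear_fst bounded_linear_snd) auto
    then have "smooth_on (S \<times> T) (\<lambda>x. snd e' (chart_inv e x))"
      by (rule smooth_on_cong[OF op, rotated])
        (auto simp: cd(1) cd'(1) inv[OF cd(2,3)] S_def T_def)
    then show ?thesis by (simp add: dom)
  qed
  have "chart_at (prod_manifold M N) p \<in> atlas (prod_manifold M N) \<and>
      p \<in> fst (chart_at (prod_manifold M N) p)" for p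
  proof (cases p)
    case (Pair q r)
    have "prod_chart (chart_at M q) (chart_at N r) \<in> atlas (prod_manifold M N)"
      using chart_at_in_atlas[OF M, of q] chart_at_in_atlas[OF N, of r]
      unfolding prod_manifold_def manifold_data.simps mem_Collect_eq by blast
    then show ?thesis using Pair in_dom_at[OF M, of q] in_dom_at[OF N, of r] by simp
  qed
  then show ?thesis
    unfolding smooth_structure_def
    using finite_span_Times[OF smooth_structure_finite_dim[OF M] smooth_structure_finite_dim[OF N]]
      chart trans by blast
qed

lemma point_at_prod:
  assumes "smooth_structure M" and "smooth_structure N"
    and "x \<in> coord_at M p ` dom_at M p" and "y \<in> coord_at N q ` dom_at N q"
  shows "point_at (prod_manifold M N) (p, q) (x, y) = (point_at M p x, point_at N q y)"
  unfolding prod_manifold_simps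
  by (rule chart_inv_prod_chart)
    (use assms in \<open>auto intro!: inj_on_inverseI point_at_coord_at\<close>)

section \<open>Smoothness at a point and the chain rule for tangent maps\<close>

text \<open>The tangent map of \<open>f\<close> at \<open>p\<close> is the derivative of this expression at the coordinates
  of \<open>p\<close>.\<close>

definition local_expr ::
  "('m, 'e::real_normed_vector) manifold_data \<Rightarrow> ('n, 'f::real_normed_vector) manifold_data \<Rightarrow>
   ('m \<Rightarrow> 'n) \<Rightarrow> 'm \<Rightarrow> 'e \<Rightarrow> 'f" where
  "local_expr M N f p = (\<lambda>x. coord_at N (f p) (f (point_at M p x)))"

text \<open>Only the chosen charts at \<open>p\<close> and \<open>f p\<close> occur. In a composition these charts fit together,
  so that the chain rule involves no change of charts.\<close>

definition smooth_at ::
  "('m, 'e::real_normed_vector) manifold_data \<Rightarrow> ('n, 'f::real_normed_vector) manifold_data \<Rightarrow>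
   ('m \<Rightarrow> 'n) \<Rightarrow> 'm \<Rightarrow> bool" where
  "smooth_at M N f p \<longleftrightarrow> (\<exists>S. open S \<and> coord_at M p p \<in> S \<and> S \<subseteq> coord_at M p ` dom_at M p \<and>
     (\<forall>x\<in>S. f (point_at M p x) \<in> dom_at N (f p)) \<and> smooth_on S (local_expr M N f p))"

lemma smooth_atI:
  assumes "open S" and "coord_at M p p \<in> S" and "S \<subseteq> coord_at M p ` dom_at M p"
    and "\<And>x. x \<in> S \<Longrightarrow> f (point_at M p x) \<in> dom_at N (f p)"
    and "smooth_on S (local_expr M N f p)"
  shows "smooth_at M N f p"
  using assms unfolding smooth_at_def by blast

lemma smooth_map_imp_smooth_at:
  assumes M: "smooth_structure M" and N: "smooth_structure N" and f: "smooth_map M N f"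
  shows "smooth_at M N f p"
proof -
  let ?W = "f -` dom_at N (f p)"
  let ?S = "coord_at M p ` (dom_at M p \<inter> ?W)"
  have "continuous_on UNIV f" using f by (simp add: smooth_map_on_def)
  then have W: "open ?W"
    by (rule open_vimage[OF open_dom_at[OF N]])
  have "smooth_on ?S (local_expr M N f p)"
    using f chart_at_in_atlas[OF M, of p] chart_at_in_atlas[OF N, of "f p"]
    unfolding smooth_map_on_def local_expr_def o_def by (fastforce simp: case_prod_beta)
  moreover have "coord_at M p p \<in> ?S"
    using in_dom_at[OF M] in_dom_at[OF N] by blast
  moreover have "\<forall>x\<in>?S. f (point_at M p x) \<in> dom_at N (f p)"
    using point_at_coord_at[OF M] by auto
  ultimately show ?thesis
    using open_coord_at_image[OF M W, of p] by (intro smooth_atI[of ?S]) auto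
qed

lemma smooth_at_has_derivative:
  assumes "smooth_at M N f p"
  shows "(local_expr M N f p has_derivative blinfun_apply (tangent_map M N f p)) (at (coord_at M p p))"
proof -
  have d: "(local_expr M N f p has_derivative
      frechet_derivative (local_expr M N f p) (at (coord_at M p p))) (at (coord_at M p p))"
    using assms smooth_on_has_derivative unfolding smooth_at_def by blast
  then have "blinfun_apply (tangent_map M N f p)
      = frechet_derivative (local_expr M N f p) (at (coord_at M p p))"
    unfolding tangent_map_def local_expr_def o_def
    by (intro bounded_linear_Blinfun_apply has_derivative_bounded_linear)
  then show ?thesis using d by simp
qed

lemma tangent_map_unique:
  assumes "(local_expr M N f p has_derivative f') (at (coord_at M p p))"
  shows "blinfun_apply (tangent_map M N f p) = f'"
proof -
  have "f' = frechet_derivative (local_expr M N f p) (at (coord_at M p p))"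
    using frechet_derivative_at[OF assms] .
  then show ?thesis
    using bounded_linear_Blinfun_apply[OF has_derivative_bounded_linear[OF assms]]
    unfolding tangent_map_def local_expr_def o_def by simp
qed

lemma local_expr_coord_at:
  "smooth_structure M \<Longrightarrow> local_expr M N f p (coord_at M p p) = coord_at N (f p) (f p)"
  by (simp add: local_expr_def point_at_coord_at in_dom_at)

text \<open>The neighbourhood on which the coordinate expression of a composition is the composition of
  the coordinate expressions; it serves both for smoothness and for the tangent map.\<close>

lemma smooth_at_compose_aux:
  assumes M: "smooth_structure M" and N: "smooth_structure N"
    and f: "smooth_at M N f p" and g: "smooth_at N K g (f p)"
  obtains S where "open S" "coord_at M p p \<in> S" "S \<subseteq> coord_at M p ` dom_at M p"
    "\<And>x. x \<in> S \<Longrightarrow> g (f (point_at M p x)) \<in> dom_at K (g (f p))"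
    "\<And>x. x \<in> S \<Longrightarrow> local_expr M K (\<lambda>x. g (f x)) p x = local_expr N K g (f p) (local_expr M N f p x)"
    "smooth_on S (\<lambda>x. local_expr N K g (f p) (local_expr M N f p x))"
proof -
  obtain S where S: "open S" "coord_at M p p \<in> S" "S \<subseteq> coord_at M p ` dom_at M p"
    "\<forall>x\<in>S. f (point_at M p x) \<in> dom_at N (f p)" "smooth_on S (local_expr M N f p)"
    using f unfolding smooth_at_def by blast
  obtain T where T: "open T" "coord_at N (f p) (f p) \<in> T" "T \<subseteq> coord_at N (f p) ` dom_at N (f p)"
    "\<forall>x\<in>T. g (point_at N (f p) x) \<in> dom_at K (g (f p))" "smooth_on T (local_expr N K g (f p))"
    using g unfolding smooth_at_def by blast
  let ?S = "S \<inter> local_expr M N f p -` T"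
  have op: "open ?S"
    using continuous_open_preimage[OF smooth_on_imp_continuous_on[OF S(5)] S(1) T(1)] .
  have ret: "point_at N (f p) (local_expr M N f p x) = f (point_at M p x)" if "x \<in> S" for x
    using S(4) that point_at_coord_at[OF N] by (simp add: local_expr_def)
  show ?thesis
  proof (rule that[of ?S])
    show "coord_at M p p \<in> ?S" using S(2) T(2) by (simp add: local_expr_coord_at[OF M])
    show "g (f (point_at M p x)) \<in> dom_at K (g (f p))" if "x \<in> ?S" for x
      using that T(4) ret[of x] by fastforce
    show "local_expr M K (\<lambda>x. g (f x)) p x = local_expr N K g (f p) (local_expr M N f p x)"
      if "x \<in> ?S" for x
      using ret[of x] that by (simp add: local_expr_def)
    show "smooth_on ?S (\<lambda>x. local_expr N K g (f p) (local_expr M N f p x))"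
      by (rule smooth_on_compose[OF smooth_structure_finite_dim[OF N] op _ _ T(5)])
        (auto intro: smooth_on_subset[OF S(5)])
  qed (use op S(3) in auto)
qed

lemma smooth_at_compose:
  assumes M: "smooth_structure M" and N: "smooth_structure N"
    and f: "smooth_at M N f p" and g: "smooth_at N K g (f p)"
  shows "smooth_at M K (\<lambda>x. g (f x)) p"
proof -
  obtain S where S: "open S" "coord_at M p p \<in> S" "S \<subseteq> coord_at M p ` dom_at M p"
    "\<And>x. x \<in> S \<Longrightarrow> g (f (point_at M p x)) \<in> dom_at K (g (f p))"
    "\<And>x. x \<in> S \<Longrightarrow> local_expr M K (\<lambda>x. g (f x)) p x = local_expr N K g (f p) (local_expr M N f p x)"
    "smooth_on S (\<lambda>x. local_expr N K g (f p) (local_expr M N f p x))"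
    using smooth_at_compose_aux[OF assms] by blast
  have "smooth_on S (local_expr M K (\<lambda>x. g (f x)) p)"
    by (rule smooth_on_cong[OF S(1) _ S(6)]) (simp add: S(5))
  then show ?thesis using S(1-4) by (intro smooth_atI[of S]) simp_all
qed

lemma tangent_map_compose:
  assumes M: "smooth_structure M" and N: "smooth_structure N"
    and f: "smooth_at M N f p" and g: "smooth_at N K g (f p)"
  shows "tangent_map M K (\<lambda>x. g (f x)) p = tangent_map N K g (f p) o\<^sub>L tangent_map M N f p"
proof -
  obtain S where S: "open S" "coord_at M p p \<in> S"
    "\<And>x. x \<in> S \<Longrightarrow> local_expr M K (\<lambda>x. g (f x)) p x = local_expr N K g (f p) (local_expr M N f p x)"
    using smooth_at_compose_aux[OF assms] by metis
  have "((\<lambda>x. local_expr N K g (f p) (local_expr M N f p x)) has_derivative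
      (\<lambda>w. tangent_map N K g (f p) (tangent_map M N f p w))) (at (coord_at M p p))"
    using diff_chain_at[OF smooth_at_has_derivative[OF f], of "local_expr N K g (f p)"
        "blinfun_apply (tangent_map N K g (f p))"]
      smooth_at_has_derivative[OF g]
    by (simp add: o_def local_expr_coord_at[OF M])
  then have "(local_expr M K (\<lambda>x. g (f x)) p has_derivative
      (\<lambda>w. tangent_map N K g (f p) (tangent_map M N f p w))) (at (coord_at M p p))"
    by (rule has_derivative_transform_within_open[OF _ S(1,2)]) (simp add: S(3))
  from tangent_map_unique[OF this] show ?thesis
    by (intro blinfun_eqI) simp
qed

lemma smooth_at_const:
  assumes "smooth_structure M" and "smooth_structure N"
  shows "smooth_at M N (\<lambda>x. c) p"
  by (rule smooth_atI[of "coord_at M p ` dom_at M p"])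
    (simp_all add: local_expr_def open_coord_at_dom in_dom_at smooth_on_const assms)

lemma tangent_map_const: "tangent_map M N (\<lambda>x. c) p = 0"
proof -
  have "blinfun_apply (tangent_map M N (\<lambda>x. c) p) = (\<lambda>_. 0)"
    by (rule tangent_map_unique) (simp add: local_expr_def)
  then show ?thesis by (intro blinfun_eqI) simp
qed

lemma smooth_at_ident:
  assumes "smooth_structure M"
  shows "smooth_at M M (\<lambda>x. x) p"
proof -
  have "smooth_on (coord_at M p ` dom_at M p) (local_expr M M (\<lambda>x. x) p)"
    by (rule smooth_on_cong[OF open_coord_at_dom[OF assms] _
          smooth_on_bounded_linear[OF open_coord_at_dom[OF assms] bounded_linear_ident]])
      (simp add: local_expr_def coord_at_point_at[OF assms])
  then show ?thesis
    using open_coord_at_dom[OF assms, of p] in_dom_at[OF assms, of p] point_at_in[OF assms, of _ p]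
    by (intro smooth_atI[of "coord_at M p ` dom_at M p"]) simp_all
qed

lemma tangent_map_ident:
  assumes "smooth_structure M"
  shows "blinfun_apply (tangent_map M M (\<lambda>x. x) p) w = w"
proof -
  have "(local_expr M M (\<lambda>x. x) p has_derivative (\<lambda>w. w)) (at (coord_at M p p))"
    by (rule has_derivative_transform_within_open[OF has_derivative_ident open_coord_at_dom[OF assms]])
      (use assms in \<open>auto simp: local_expr_def coord_at_point_at in_dom_at\<close>)
  from tangent_map_unique[OF this] show ?thesis by simp
qed

lemma local_expr_Pair:
  "local_expr M (prod_manifold N K) (\<lambda>x. (f x, g x)) p = (\<lambda>x. (local_expr M N f p x, local_expr M K g p x))"
  by (simp add: local_expr_def)

lemma smooth_at_Pair:
  assumes "smooth_at M N f p" and "smooth_at M K g p"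
  shows "smooth_at M (prod_manifold N K) (\<lambda>x. (f x, g x)) p"
proof -
  obtain S where S: "open S" "coord_at M p p \<in> S" "S \<subseteq> coord_at M p ` dom_at M p"
    "\<forall>x\<in>S. f (point_at M p x) \<in> dom_at N (f p)" "smooth_on S (local_expr M N f p)"
    using assms(1) unfolding smooth_at_def by blast
  obtain T where T: "open T" "coord_at M p p \<in> T"
    "\<forall>x\<in>T. g (point_at M p x) \<in> dom_at K (g p)" "smooth_on T (local_expr M K g p)"
    using assms(2) unfolding smooth_at_def by blast
  have "smooth_on (S \<inter> T) (local_expr M (prod_manifold N K) (\<lambda>x. (f x, g x)) p)"
    unfolding local_expr_Pair using S T by (intro smooth_on_Pair) (auto intro: smooth_on_subset)
  then show ?thesis
    using S T by (intro smooth_atI[of "S \<inter> T"]) auto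
qed

lemma tangent_map_Pair:
  assumes "smooth_at M N f p" and "smooth_at M K g p"
  shows "blinfun_apply (tangent_map M (prod_manifold N K) (\<lambda>x. (f x, g x)) p) w
    = (tangent_map M N f p w, tangent_map M K g p w)"
proof -
  have "(local_expr M (prod_manifold N K) (\<lambda>x. (f x, g x)) p has_derivative
      (\<lambda>w. (tangent_map M N f p w, tangent_map M K g p w))) (at (coord_at M p p))"
    unfolding local_expr_Pair
    by (intro has_derivative_Pair smooth_at_has_derivative assms)
  from tangent_map_unique[OF this] show ?thesis by simp
qed

context
  fixes M :: "('m::topological_space, 'e::real_normed_vector) manifold_data"
    and N :: "('n::topological_space, 'f::real_normed_vector) manifold_data"
  assumes M: "smooth_structure M" and N: "smooth_structure N"
begin

lemma local_expr_fst_snd: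
  assumes "z \<in> coord_at (prod_manifold M N) (p, q) ` dom_at (prod_manifold M N) (p, q)"
  shows "local_expr (prod_manifold M N) M fst (p, q) z = fst z"
    and "local_expr (prod_manifold M N) N snd (p, q) z = snd z"
proof -
  obtain x y where "z = (x, y)" "x \<in> coord_at M p ` dom_at M p" "y \<in> coord_at N q ` dom_at N q"
    using assms by auto
  then show "local_expr (prod_manifold M N) M fst (p, q) z = fst z"
    "local_expr (prod_manifold M N) N snd (p, q) z = snd z"
    using M N point_at_prod[OF M N, of x p y q] coord_at_point_at[OF M, of x p]
      coord_at_point_at[OF N, of y q] by (simp_all add: local_expr_def)
qed

lemma smooth_at_fst_snd:
  "smooth_at (prod_manifold M N) M fst (p, q)" "smooth_at (prod_manifold M N) N snd (p, q)"
proof -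
  let ?D = "coord_at (prod_manifold M N) (p, q) ` dom_at (prod_manifold M N) (p, q)"
  note P = smooth_structure_prod[OF M N]
  note op = open_coord_at_dom[OF P, of "(p, q)"]
  have s: "smooth_on ?D (local_expr (prod_manifold M N) M fst (p, q))"
    "smooth_on ?D (local_expr (prod_manifold M N) N snd (p, q))"
    by (rule smooth_on_cong[OF op _ smooth_on_bounded_linear[OF op bounded_linear_fst]],
        simp only: local_expr_fst_snd)
      (rule smooth_on_cong[OF op _ smooth_on_bounded_linear[OF op bounded_linear_snd]],
        simp only: local_expr_fst_snd)
  have d: "fst (point_at (prod_manifold M N) (p, q) z) \<in> dom_at M p"
    "snd (point_at (prod_manifold M N) (p, q) z) \<in> dom_at N q" if "z \<in> ?D" for z
    using point_at_in[OF P that] by auto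
  have i: "coord_at (prod_manifold M N) (p, q) (p, q) \<in> ?D" using in_dom_at[OF P] by blast
  show "smooth_at (prod_manifold M N) M fst (p, q)" "smooth_at (prod_manifold M N) N snd (p, q)"
    by (rule smooth_atI[OF op i order_refl _ s(1)], simp only: fst_conv d)
      (rule smooth_atI[OF op i order_refl _ s(2)], simp only: snd_conv d)
qed

lemma tangent_map_fst_snd:
  "blinfun_apply (tangent_map (prod_manifold M N) M fst (p, q)) w = fst w"
  "blinfun_apply (tangent_map (prod_manifold M N) N snd (p, q)) w = snd w"
proof -
  note P = smooth_structure_prod[OF M N]
  note op = open_coord_at_dom[OF P, of "(p, q)"]
  have i: "coord_at (prod_manifold M N) (p, q) (p, q)
      \<in> coord_at (prod_manifold M N) (p, q) ` dom_at (prod_manifold M N) (p, q)"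
    using in_dom_at[OF P] by blast
  have "(local_expr (prod_manifold M N) M fst (p, q) has_derivative fst)
      (at (coord_at (prod_manifold M N) (p, q) (p, q)))"
    by (rule has_derivative_transform_within_open
        [OF bounded_linear_imp_has_derivative[OF bounded_linear_fst] op i])
      (simp only: local_expr_fst_snd)
  from tangent_map_unique[OF this]
  show "blinfun_apply (tangent_map (prod_manifold M N) M fst (p, q)) w = fst w" by simp
  have "(local_expr (prod_manifold M N) N snd (p, q) has_derivative snd)
      (at (coord_at (prod_manifold M N) (p, q) (p, q)))"
    by (rule has_derivative_transform_within_open
        [OF bounded_linear_imp_has_derivative[OF bounded_linear_snd] op i])
      (simp only: local_expr_fst_snd)
  from tangent_map_unique[OF this]
  show "blinfun_apply (tangent_map (prod_manifold M N) N snd (p, q)) w = snd w" by simp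
qed

lemma smooth_at_slices:
  "smooth_at M (prod_manifold M N) (\<lambda>x. (x, q)) p" "smooth_at N (prod_manifold M N) (\<lambda>y. (p, y)) q"
  by (intro smooth_at_Pair smooth_at_ident smooth_at_const M N)+

lemma smooth_at_partial:
  assumes "smooth_at (prod_manifold M N) K f (p, q)"
  shows "smooth_at M K (\<lambda>x. f (x, q)) p" and "smooth_at N K (\<lambda>y. f (p, y)) q"
  using smooth_at_compose[OF M smooth_structure_prod[OF M N] smooth_at_slices(1) assms]
    smooth_at_compose[OF N smooth_structure_prod[OF M N] smooth_at_slices(2) assms] by auto

text \<open>The total derivative is the sum of the partial ones: restrict along the two slices
  \<open>x \<mapsto> (x, q)\<close> and \<open>y \<mapsto> (p, y)\<close>, whose tangent maps are the two inclusions.\<close>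

lemma tangent_map_partial:
  assumes "smooth_at (prod_manifold M N) K f (p, q)"
  shows "blinfun_apply (tangent_map (prod_manifold M N) K f (p, q)) (a, b)
    = tangent_map M K (\<lambda>x. f (x, q)) p a + tangent_map N K (\<lambda>y. f (p, y)) q b"
proof -
  have "tangent_map M K (\<lambda>x. f (x, q)) p a = tangent_map (prod_manifold M N) K f (p, q) (a, 0)"
    using tangent_map_compose[OF M smooth_structure_prod[OF M N] smooth_at_slices(1) assms]
    by (simp add: tangent_map_Pair smooth_at_ident smooth_at_const M N tangent_map_ident tangent_map_const)
  moreover have "tangent_map N K (\<lambda>y. f (p, y)) q b = tangent_map (prod_manifold M N) K f (p, q) (0, b)"
    using tangent_map_compose[OF N smooth_structure_prod[OF M N] smooth_at_slices(2) assms]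
    by (simp add: tangent_map_Pair smooth_at_ident smooth_at_const M N tangent_map_ident tangent_map_const)
  ultimately show ?thesis
    by (simp flip: blinfun.add_right)
qed

end

text \<open>The chart at \<open>p\<close> is also differentiated at other points \<open>q\<close>, where tangent vectors refer to
  the chart at \<open>q\<close>. This is where the smoothness of the transition maps is needed.\<close>

lemma smooth_at_coord_at:
  assumes M: "smooth_structure M" and q: "q \<in> dom_at M p"
  shows "smooth_at M vs_manifold (coord_at M p) q"
proof -
  let ?S = "coord_at M q ` (dom_at M q \<inter> dom_at M p)"
  have "smooth_on ?S (local_expr M vs_manifold (coord_at M p) q)"
    using M chart_at_in_atlas[OF M] by (simp add: local_expr_def smooth_structure_def)
  then show ?thesis
    using open_coord_at_image[OF M open_dom_at[OF M], of q p] q in_dom_at[OF M, of q]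
    by (intro smooth_atI[of ?S]) auto
qed

lemma smooth_at_fst:
  assumes "smooth_structure A" and "smooth_structure M" and "smooth_structure N"
    and "smooth_at A (prod_manifold M N) f p"
  shows "smooth_at A M (\<lambda>x. fst (f x)) p"
  using assms smooth_at_fst_snd(1)[OF assms(2,3), of "fst (f p)" "snd (f p)"]
  by (intro smooth_at_compose[OF assms(1) smooth_structure_prod assms(4)]) auto

lemma smooth_at_snd:
  assumes "smooth_structure A" and "smooth_structure M" and "smooth_structure N"
    and "smooth_at A (prod_manifold M N) f p"
  shows "smooth_at A N (\<lambda>x. snd (f x)) p"
  using assms smooth_at_fst_snd(2)[OF assms(2,3), of "fst (f p)" "snd (f p)"]
  by (intro smooth_at_compose[OF assms(1) smooth_structure_prod assms(4)]) auto

lemma smooth_at_compose2: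
  assumes "smooth_structure A" and "smooth_structure M" and "smooth_structure N"
    and "smooth_at A M f p" and "smooth_at A N g p"
    and "smooth_at (prod_manifold M N) K (\<lambda>(x, y). b x y) (f p, g p)"
  shows "smooth_at A K (\<lambda>x. b (f x) (g x)) p"
  using smooth_at_compose[OF assms(1) smooth_structure_prod[OF assms(2,3)]
      smooth_at_Pair[OF assms(4,5)] assms(6)] by simp

lemma tangent_map_compose2:
  assumes "smooth_structure A" and "smooth_structure M" and "smooth_structure N"
    and "smooth_at A M f p" and "smooth_at A N g p"
    and "smooth_at (prod_manifold M N) K (\<lambda>(x, y). b x y) (f p, g p)"
  shows "blinfun_apply (tangent_map A K (\<lambda>x. b (f x) (g x)) p) w =
    tangent_map M K (\<lambda>x. b x (g p)) (f p) (tangent_map A M f p w) +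
    tangent_map N K (\<lambda>y. b (f p) y) (g p) (tangent_map A N g p w)"
  using tangent_map_compose[OF assms(1) smooth_structure_prod[OF assms(2,3)]
      smooth_at_Pair[OF assms(4,5)] assms(6)] assms
  by (simp add: tangent_map_Pair tangent_map_partial)

lemma tangent_map_compose_apply:
  assumes "smooth_structure M" and "smooth_structure N"
    and "smooth_at M N f p" and "smooth_at N K g q" and "f p = q"
  shows "blinfun_apply (tangent_map M K (\<lambda>x. g (f x)) p) w =
    tangent_map N K g q (tangent_map M N f p w)"
  using tangent_map_compose[OF assms(1,2,3), of K g] assms(4,5) by simp

section \<open>The bracket of left invariant vector fields\<close>

text \<open>The bracket of left invariant fields at the unit depends only on the product near the unit
  and on \<open>g * 1 = g\<close>. Isolating this makes its bilinearity available for the double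
  cross product as soon as the product there is known to be smooth.\<close>

locale smooth_right_unital =
  fixes G :: "('g::topological_space, 'e::real_normed_vector) lie_group_data"
  assumes smooth_structure: "smooth_structure (mfd G)"
    and smooth_at_mult: "smooth_at (prod_manifold (mfd G) (mfd G)) (mfd G) (\<lambda>(g, k). mult G g k) (g, k)"
    and mult_unit: "mult G g (unit G) = g"
begin

abbreviation (input) one where "one \<equiv> unit G"
abbreviation (input) x0 where "x0 \<equiv> coord_at (mfd G) one one"

definition mult_expr :: "'e \<times> 'e \<Rightarrow> 'e" where
  "mult_expr = local_expr (prod_manifold (mfd G) (mfd G)) (mfd G) (\<lambda>(g, k). mult G g k) (one, one)"

lemma mult_expr_eq:
  assumes "x \<in> coord_at (mfd G) one ` dom_at (mfd G) one" "y \<in> coord_at (mfd G) one ` dom_at (mfd G) one"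
  shows "mult_expr (x, y) = coord_at (mfd G) one
    (mult G (point_at (mfd G) one x) (point_at (mfd G) one y))"
  using point_at_prod[OF smooth_structure smooth_structure assms]
  by (simp add: mult_expr_def local_expr_def mult_unit)

text \<open>In coordinates, a left invariant field is a partial derivative of the product:
  by the chain rule the charts at the various points \<open>q\<close>, in which the values of the field are
  given, cancel. The right-hand side is smooth in \<open>x\<close>, so the field is smooth although
  the choice of the charts at \<open>q\<close> is arbitrary.\<close>

lemma left_invariant_field_local_rep:
  obtains S where "open S" and "x0 \<in> S"
    and "\<And>x \<xi>. x \<in> S \<Longrightarrow> local_rep (mfd G) one (left_invariant_field G \<xi>) x
      = frechet_derivative mult_expr (at (x, x0)) (0, \<xi>)"
    and "\<And>\<xi>. smooth_on S (\<lambda>x. frechet_derivative mult_expr (at (x, x0)) (0, \<xi>))"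
proof -
  let ?M = "mfd G" and ?D = "coord_at (mfd G) one ` dom_at (mfd G) one"
  note str = smooth_structure
  obtain W where W: "open W" "(x0, x0) \<in> W" "W \<subseteq> ?D \<times> ?D" "smooth_on W mult_expr"
    using smooth_at_mult[of one one] unfolding smooth_at_def mult_expr_def
    by (auto simp: map_prod_surj_on)
  define S where "S = (\<lambda>x. (x, x0)) -` W"
  show ?thesis
  proof (rule that[of S])
    show op: "open S"
      unfolding S_def by (intro open_vimage W(1) continuous_intros)
    show "x0 \<in> S" using W(2) by (simp add: S_def)
    show "smooth_on S (\<lambda>x. frechet_derivative mult_expr (at (x, x0)) (0, \<xi>))" for \<xi>
    proof (rule smooth_on_compose[where g = "\<lambda>z. frechet_derivative mult_expr (at z) (0, \<xi>)" and T = W])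
      show "\<exists>B::('e \<times> 'e) set. finite B \<and> span B = UNIV"
        by (intro finite_span_Times smooth_structure_finite_dim[OF str])
      show "smooth_on S (\<lambda>x. (x, x0))"
        by (intro smooth_on_Pair op smooth_on_const smooth_on_bounded_linear bounded_linear_ident)
      show "smooth_on W (\<lambda>z. frechet_derivative mult_expr (at z) (0, \<xi>))"
        by (rule smooth_on_frechet_derivative[OF W(4)])
    qed (use op in \<open>auto simp: S_def\<close>)
    fix x \<xi> assume x: "x \<in> S"
    then have xD: "x \<in> ?D" using W(3) by (auto simp: S_def)
    let ?q = "point_at ?M one x"
    have q: "?q \<in> dom_at ?M one" by (rule point_at_in[OF str xD])
    have sm: "smooth_at ?M ?M (mult G ?q) one"
      using smooth_at_partial(2)[OF str str smooth_at_mult[of ?q one]] by simp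
    have "local_rep ?M one (left_invariant_field G \<xi>) x
        = tangent_map ?M vs_manifold (\<lambda>k. coord_at ?M one (mult G ?q k)) one \<xi>"
      using tangent_map_compose_apply[OF str str sm smooth_at_coord_at[OF str q]]
      by (simp add: local_rep_def left_invariant_field_def mult_unit Let_def)
    also have "\<dots> = frechet_derivative mult_expr (at (x, x0)) (0, \<xi>)"
    proof -
      have "(mult_expr has_derivative frechet_derivative mult_expr (at (x, x0))) (at (x, x0))"
        by (rule smooth_on_has_derivative[OF W(4)]) (use x in \<open>simp add: S_def\<close>)
      moreover have "((\<lambda>y. (x, y)) has_derivative (\<lambda>w. (0, w))) (at x0)"
        by (intro derivative_eq_intros) auto
      ultimately have "((\<lambda>y. mult_expr (x, y)) has_derivative
          (\<lambda>w. frechet_derivative mult_expr (at (x, x0)) (0, w))) (at x0)"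
        using diff_chain_at[of "\<lambda>y. (x, y)" "\<lambda>w. (0, w)" x0 mult_expr] by (simp add: o_def)
      then have "(local_expr ?M vs_manifold (\<lambda>k. coord_at ?M one (mult G ?q k)) one has_derivative
          (\<lambda>w. frechet_derivative mult_expr (at (x, x0)) (0, w))) (at x0)"
        by (rule has_derivative_transform_within_open[OF _ open_coord_at_dom[OF str, of one]])
          (use in_dom_at[OF str] in \<open>auto simp: mult_expr_eq[OF xD] local_expr_def\<close>)
      from tangent_map_unique[OF this] show ?thesis by simp
    qed
    finally show "local_rep ?M one (left_invariant_field G \<xi>) x
      = frechet_derivative mult_expr (at (x, x0)) (0, \<xi>)" .
  qed
qed

lemma left_invariant_field_has_derivative:
  "(local_rep (mfd G) one (left_invariant_field G \<xi>) has_derivative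
    frechet_derivative (local_rep (mfd G) one (left_invariant_field G \<xi>)) (at x0)) (at x0)"
proof -
  obtain S where S: "open S" "x0 \<in> S"
    "\<And>x \<xi>. x \<in> S \<Longrightarrow> local_rep (mfd G) one (left_invariant_field G \<xi>) x
      = frechet_derivative mult_expr (at (x, x0)) (0, \<xi>)"
    "\<And>\<xi>. smooth_on S (\<lambda>x. frechet_derivative mult_expr (at (x, x0)) (0, \<xi>))"
    using left_invariant_field_local_rep by metis
  have "smooth_on S (local_rep (mfd G) one (left_invariant_field G \<xi>))"
    by (rule smooth_on_cong[OF S(1) _ S(4)]) (simp add: S(3))
  then show ?thesis using S(2) smooth_on_has_derivative by blast
qed

lemma lie_bracket_eq:
  "lie_bracket G \<xi> \<zeta> =
    (let X = local_rep (mfd G) one (left_invariant_field G \<xi>);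
         Y = local_rep (mfd G) one (left_invariant_field G \<zeta>)
     in frechet_derivative Y (at x0) (X x0) - frechet_derivative X (at x0) (Y x0))"
  by (simp add: lie_bracket_def vector_field_bracket_def Let_def)

lemma lie_bracket_antisym: "lie_bracket G \<xi> \<zeta> = - lie_bracket G \<zeta> \<xi>"
  by (simp add: lie_bracket_eq Let_def)

text \<open>A left invariant field is linear in its generator, and so is its derivative, because these
  fields are differentiable; \<open>frechet_derivative\<close> is additive only on differentiable maps.\<close>

lemma linear_lie_bracket: "linear (lie_bracket G \<xi>)"
proof -
  let ?X = "\<lambda>\<xi>. local_rep (mfd G) one (left_invariant_field G \<xi>)"
  note D = left_invariant_field_has_derivative
  have lin: "linear (frechet_derivative (?X \<xi>) (at x0))" for \<xi>
    using D has_derivative_linear by blast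
  have add: "?X (a + b) = (\<lambda>x. ?X a x + ?X b x)" for a b
    by (rule ext) (simp add: local_rep_def left_invariant_field_def Let_def blinfun.add_right)
  have scale: "?X (r *\<^sub>R a) = (\<lambda>x. r *\<^sub>R ?X a x)" for r a
    by (rule ext) (simp add: local_rep_def left_invariant_field_def Let_def blinfun.scaleR_right)
  have Dadd: "frechet_derivative (?X (a + b)) (at x0)
      = (\<lambda>w. frechet_derivative (?X a) (at x0) w + frechet_derivative (?X b) (at x0) w)" for a b
    unfolding add by (rule frechet_derivative_at[symmetric]) (intro has_derivative_add D)
  have Dscale: "frechet_derivative (?X (r *\<^sub>R a)) (at x0)
      = (\<lambda>w. r *\<^sub>R frechet_derivative (?X a) (at x0) w)" for r a
    unfolding scale by (rule frechet_derivative_at[symmetric]) (intro has_derivative_scaleR_right D)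
  show ?thesis
    unfolding lie_bracket_eq Let_def
    by (intro linearI)
      (simp_all only: Dadd Dscale, simp_all add: add scale linear_add[OF lin] linear_cmul[OF lin] algebra_simps)
qed

text \<open>The transposes in the equations of motion are built with \<open>Blinfun\<close>, which is faithful on
  bounded maps only.\<close>

lemma bounded_linear_lie_bracket: "bounded_linear (lie_bracket G \<xi>)"
  using linear_imp_bounded_linear_finite_span[OF _ _ linear_lie_bracket]
    smooth_structure_finite_dim[OF smooth_structure] by blast

lemma lie_bracket_add_right: "lie_bracket G \<xi> (a + b) = lie_bracket G \<xi> a + lie_bracket G \<xi> b"
  by (rule linear_add[OF linear_lie_bracket])

lemma lie_bracket_add_left: "lie_bracket G (a + b) \<xi> = lie_bracket G a \<xi> + lie_bracket G b \<xi>"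
  using lie_bracket_antisym lie_bracket_add_right by (metis minus_add_distrib)

end

section \<open>The Lie algebra of the cocycle double cross product\<close>

locale cocycle_pair =
  fixes P :: "('m::{t2_space,second_countable_topology}, 'e::real_normed_vector,
    'h::{t2_space,second_countable_topology}, 'f::real_normed_vector) matched_pair_data"
  assumes P: "cocycle_matched_pair P"
begin

abbreviation M where "M \<equiv> MM P"
abbreviation H where "H \<equiv> mfd (HH P)"
abbreviation mul where "mul \<equiv> mult (HH P)"
abbreviation e where "e \<equiv> unit (HH P)"
abbreviation b where "b \<equiv> base P"
abbreviation G where "G \<equiv> cocycle_dcp P"

lemma smooth_structures: "smooth_structure M" "smooth_structure H" "smooth_structure (mfd G)"
proof -
  have "smooth_manifold M" "smooth_manifold H"
    using P unfolding cocycle_matched_pair_def lie_group_def Let_def by blast+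
  then show "smooth_structure M" "smooth_structure H"
    by (simp_all add: smooth_manifold_imp_smooth_structure)
  then show "smooth_structure (mfd G)"
    by (simp add: cocycle_dcp_def smooth_structure_prod)
qed

lemmas Mstr = smooth_structures(1) and Hstr = smooth_structures(2) and Gstr = smooth_structures(3)

lemma smooth_at_structure_maps:
  "smooth_at (prod_manifold H M) M (\<lambda>(h, m). act P h m) (h, m)"
  "smooth_at (prod_manifold H M) H (\<lambda>(h, m). sig P h m) (h, m)"
  "smooth_at (prod_manifold M M) M (\<lambda>(m, n). dot P m n) (m, n)"
  "smooth_at (prod_manifold M M) H (\<lambda>(m, n). gam P m n) (m, n)"
  "smooth_at (prod_manifold H H) H (\<lambda>(h, k). mul h k) (h, k)"
  using P unfolding cocycle_matched_pair_def lie_group_def Let_def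
  by (auto intro!: smooth_map_imp_smooth_at smooth_structure_prod Mstr Hstr)

lemma units [simp]:
  "mul e h = h" "mul h e = h" "act P h b = b" "act P e m = m" "sig P h b = h" "sig P e m = e"
  "dot P m b = m" "dot P b m = m" "gam P m b = e" "gam P b m = e"
proof -
  have "lie_group (HH P)" using P unfolding cocycle_matched_pair_def Let_def by blast
  then obtain i where "group mul e i"
    unfolding lie_group_def by blast
  then interpret group mul e i .
  show "mul e h = h" "mul h e = h" by simp_all
qed (use P in \<open>simp_all add: cocycle_matched_pair_def Let_def\<close>)

lemma mult_dcp:
  "mult G (m, h) (n, k) = (dot P m (act P h n), mul (mul (gam P m (act P h n)) (sig P h n)) k)"
  by (simp add: cocycle_dcp_def)

lemma dcp_simps: "unit G = (b, e)" "mfd G = prod_manifold M H"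
  by (simp_all add: cocycle_dcp_def)

text \<open>The product is an expression in the four projections and the structure maps.\<close>

lemma smooth_at_mult_dcp:
  "smooth_at (prod_manifold (mfd G) (mfd G)) (mfd G) (\<lambda>(g, k). mult G g k) z"
proof -
  let ?Q = "prod_manifold (mfd G) (mfd G)"
  note Q = smooth_structure_prod[OF Gstr Gstr]
  have id: "smooth_at ?Q ?Q (\<lambda>z. z) z" by (rule smooth_at_ident[OF Q])
  have p: "smooth_at ?Q (prod_manifold M H) (\<lambda>z. fst z) z" "smooth_at ?Q (prod_manifold M H) (\<lambda>z. snd z) z"
    using smooth_at_fst[OF Q Gstr Gstr id] smooth_at_snd[OF Q Gstr Gstr id] by (simp_all add: dcp_simps)
  note pr = smooth_at_fst[OF Q Mstr Hstr p(1)] smooth_at_snd[OF Q Mstr Hstr p(1)]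
    smooth_at_fst[OF Q Mstr Hstr p(2)] smooth_at_snd[OF Q Mstr Hstr p(2)]
  note s = smooth_at_structure_maps
  note act = smooth_at_compose2[OF Q Hstr Mstr pr(2) pr(3) s(1)]
  have "smooth_at ?Q (prod_manifold M H) (\<lambda>z. (dot P (fst (fst z)) (act P (snd (fst z)) (fst (snd z))),
      mul (mul (gam P (fst (fst z)) (act P (snd (fst z)) (fst (snd z)))) (sig P (snd (fst z)) (fst (snd z))))
        (snd (snd z)))) z"
    by (rule smooth_at_Pair[OF smooth_at_compose2[OF Q Mstr Mstr pr(1) act s(3)]
          smooth_at_compose2[OF Q Hstr Hstr smooth_at_compose2[OF Q Hstr Hstr
            smooth_at_compose2[OF Q Mstr Mstr pr(1) act s(4)]
            smooth_at_compose2[OF Q Hstr Mstr pr(2) pr(3) s(2)] s(5)] pr(4) s(5)]])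
  moreover have "(\<lambda>z. (dot P (fst (fst z)) (act P (snd (fst z)) (fst (snd z))),
      mul (mul (gam P (fst (fst z)) (act P (snd (fst z)) (fst (snd z)))) (sig P (snd (fst z)) (fst (snd z))))
        (snd (snd z)))) = (\<lambda>(g, k). mult G g k)"
    by (auto simp: mult_dcp fun_eq_iff)
  ultimately show ?thesis by (simp add: dcp_simps)
qed

sublocale dcp: smooth_right_unital G
  by unfold_locales (auto simp: Gstr smooth_at_mult_dcp, auto simp: dcp_simps mult_dcp)

sublocale HH: smooth_right_unital "HH P"
  by unfold_locales (use Hstr smooth_at_structure_maps in auto)

text \<open>This is where the group terms of the equations come from. In the \<open>M\<close> direction the second
  component \<open>\<gamma>(m, h \<triangleright> n) * \<sigma>(h, n)\<close> has two factors, equal to \<open>1\<close> and \<open>h\<close> at \<open>n = o\<close>. The product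
  rule in \<open>H\<close> therefore leaves \<open>T\<sigma>\<^sub>h\<close> untouched and composes \<open>T\<gamma>\<^sub>m\<close> with the right
  translation by \<open>h\<close>. In the \<open>H\<close> direction the product is just \<open>(m, h * k)\<close>.\<close>

lemma tangent_map_mult_dcp:
  "blinfun_apply (tangent_map (mfd G) (mfd G) (mult G (m, h)) (unit G)) (w, \<zeta>) =
    (tangent_map M M (dot P m) b (tangent_map M M (act P h) b w),
     tangent_map M H (\<lambda>n. mul (gam P m n) h) b (tangent_map M M (act P h) b w)
     + tangent_map M H (sig P h) b w + tangent_map H H (mul h) e \<zeta>)"
proof -
  let ?R = "prod_manifold M H"
  note R = smooth_structure_prod[OF Mstr Hstr]
  note s = smooth_at_structure_maps
  have pr: "smooth_at ?R M fst (b, e)" "smooth_at ?R H snd (b, e)"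
    by (rule smooth_at_fst_snd[OF Mstr Hstr])+
  have act: "smooth_at M M (act P h) b" and sig: "smooth_at M H (sig P h) b"
    and dot: "smooth_at M M (dot P m) b" and gam: "smooth_at M H (gam P m) b"
    and mulr: "smooth_at H H (\<lambda>k. mul k h) e"
    using smooth_at_partial(2)[OF Hstr Mstr s(1)] smooth_at_partial(2)[OF Hstr Mstr s(2)]
      smooth_at_partial(2)[OF Mstr Mstr s(3)] smooth_at_partial(2)[OF Mstr Mstr s(4)]
      smooth_at_partial(1)[OF Hstr Hstr s(5)] by simp_all
  have dact: "smooth_at M M (\<lambda>n. dot P m (act P h n)) b"
    by (rule smooth_at_compose[OF Mstr Mstr act]) (simp add: dot)
  have gact: "smooth_at M H (\<lambda>n. gam P m (act P h n)) b"
    by (rule smooth_at_compose[OF Mstr Mstr act]) (simp add: gam)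
  have gs: "smooth_at M H (\<lambda>n. mul (gam P m (act P h n)) (sig P h n)) b"
    by (rule smooth_at_compose2[OF Mstr Hstr Hstr gact sig s(5)])
  have 1: "smooth_at ?R M (\<lambda>z. dot P m (act P h (fst z))) (b, e)"
    by (rule smooth_at_compose[OF R Mstr pr(1)]) (simp add: dact)
  have gsf: "smooth_at ?R H (\<lambda>z. mul (gam P m (act P h (fst z))) (sig P h (fst z))) (b, e)"
    by (rule smooth_at_compose[OF R Mstr pr(1)]) (simp add: gs)
  have 2: "smooth_at ?R H (\<lambda>z. mul (mul (gam P m (act P h (fst z))) (sig P h (fst z))) (snd z)) (b, e)"
    by (rule smooth_at_compose2[OF R Hstr Hstr gsf pr(2) s(5)])
  have "tangent_map ?R M (\<lambda>z. dot P m (act P h (fst z))) (b, e) (w, \<zeta>)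
      = tangent_map M M (dot P m) b (tangent_map M M (act P h) b w)"
    using tangent_map_compose_apply[OF R Mstr pr(1) dact]
      tangent_map_compose_apply[OF Mstr Mstr act dot]
    by (simp add: tangent_map_fst_snd[OF Mstr Hstr])
  moreover have "tangent_map ?R H (\<lambda>z. mul (mul (gam P m (act P h (fst z))) (sig P h (fst z))) (snd z)) (b, e) (w, \<zeta>)
      = tangent_map M H (\<lambda>n. mul (gam P m n) h) b (tangent_map M M (act P h) b w)
        + tangent_map M H (sig P h) b w + tangent_map H H (mul h) e \<zeta>"
  proof -
    have "tangent_map ?R H (\<lambda>z. mul (mul (gam P m (act P h (fst z))) (sig P h (fst z))) (snd z)) (b, e) (w, \<zeta>)
      = tangent_map M H (\<lambda>n. mul (gam P m (act P h n)) (sig P h n)) b w + tangent_map H H (mul h) e \<zeta>"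
      using tangent_map_partial[OF Mstr Hstr 2] by simp
    also have "tangent_map M H (\<lambda>n. mul (gam P m (act P h n)) (sig P h n)) b w
      = tangent_map H H (\<lambda>k. mul k h) e (tangent_map M H (\<lambda>n. gam P m (act P h n)) b w)
        + tangent_map M H (sig P h) b w"
      using tangent_map_compose2[OF Mstr Hstr Hstr gact sig s(5), of w]
      by (simp add: tangent_map_ident[OF Hstr])
    also have "tangent_map M H (\<lambda>n. gam P m (act P h n)) b w
      = tangent_map M H (gam P m) b (tangent_map M M (act P h) b w)"
      using tangent_map_compose_apply[OF Mstr Mstr act gam] by simp
    also have "tangent_map H H (\<lambda>k. mul k h) e (tangent_map M H (gam P m) b (tangent_map M M (act P h) b w))
      = tangent_map M H (\<lambda>n. mul (gam P m n) h) b (tangent_map M M (act P h) b w)"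
      using tangent_map_compose_apply[OF Mstr Hstr gam mulr] by simp
    finally show ?thesis .
  qed
  moreover have "mult G (m, h) = (\<lambda>z. (dot P m (act P h (fst z)),
      mul (mul (gam P m (act P h (fst z))) (sig P h (fst z))) (snd z)))"
    by (auto simp: mult_dcp fun_eq_iff)
  ultimately show ?thesis
    using tangent_map_Pair[OF 1 2, of "(w, \<zeta>)"] by (simp add: dcp_simps)
qed

text \<open>The fields generated by the Lie algebra of \<open>H\<close> are tangent to the fibres \<open>{m} \<times> H\<close> and do
  not depend on \<open>m\<close>. The same holds for their coordinate expressions, hence their brackets are
  those of \<open>H\<close>.\<close>

lemma left_invariant_field_vertical:
  "left_invariant_field G (0, \<eta>) (m, h) = (0, left_invariant_field (HH P) \<eta> h)"
  by (simp add: left_invariant_field_def tangent_map_mult_dcp)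

lemma local_rep_vertical:
  assumes "x \<in> coord_at M b ` dom_at M b" and "y \<in> coord_at H e ` dom_at H e"
  shows "local_rep (mfd G) (unit G) (left_invariant_field G (0, \<eta>)) (x, y)
    = (0, local_rep H e (left_invariant_field (HH P) \<eta>) y)"
proof -
  let ?m = "point_at M b x" and ?h = "point_at H e y"
  have q: "point_at (prod_manifold M H) (b, e) (x, y) = (?m, ?h)"
    by (rule point_at_prod[OF Mstr Hstr assms])
  note sm = smooth_at_coord_at[OF Mstr point_at_in[OF Mstr assms(1)]]
    smooth_at_coord_at[OF Hstr point_at_in[OF Hstr assms(2)]]
  note R = smooth_structure_prod[OF Mstr Hstr]
  have c: "coord_at (prod_manifold M H) (b, e) = (\<lambda>z. (coord_at M b (fst z), coord_at H e (snd z)))"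
    by (auto simp: fun_eq_iff)
  have "tangent_map (prod_manifold M H) vs_manifold (coord_at (prod_manifold M H) (b, e)) (?m, ?h) (u, w)
      = (tangent_map M vs_manifold (coord_at M b) ?m u, tangent_map H vs_manifold (coord_at H e) ?h w)" for u w
  proof -
    have 1: "smooth_at (prod_manifold M H) vs_manifold (\<lambda>z. coord_at M b (fst z)) (?m, ?h)"
      by (rule smooth_at_compose[OF R Mstr smooth_at_fst_snd(1)[OF Mstr Hstr]]) (simp add: sm)
    have 2: "smooth_at (prod_manifold M H) vs_manifold (\<lambda>z. coord_at H e (snd z)) (?m, ?h)"
      by (rule smooth_at_compose[OF R Hstr smooth_at_fst_snd(2)[OF Mstr Hstr]]) (simp add: sm)
    show ?thesis
      unfolding c
      using tangent_map_Pair[OF 1 2, of "(u, w)"]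
        tangent_map_compose_apply[OF R Mstr smooth_at_fst_snd(1)[OF Mstr Hstr] sm(1)]
        tangent_map_compose_apply[OF R Hstr smooth_at_fst_snd(2)[OF Mstr Hstr] sm(2)]
      by (simp add: prod_vs_manifold tangent_map_fst_snd[OF Mstr Hstr])
  qed
  then show ?thesis
    unfolding local_rep_def dcp_simps Let_def q left_invariant_field_vertical by simp
qed

lemma lie_bracket_vertical: "lie_bracket G (0, \<eta>) (0, \<zeta>) = (0, lie_bracket (HH P) \<eta> \<zeta>)"
proof -
  let ?X = "\<lambda>\<eta>. local_rep (mfd G) (unit G) (left_invariant_field G (0, \<eta>))"
  let ?Y = "\<lambda>\<eta>. local_rep H e (left_invariant_field (HH P) \<eta>)"
  let ?x = "coord_at M b b" and ?y = "coord_at H e e"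
  let ?D = "(coord_at M b ` dom_at M b) \<times> (coord_at H e ` dom_at H e)"
  have op: "open ?D" by (intro open_Times open_coord_at_dom Mstr Hstr)
  have i: "(?x, ?y) \<in> ?D" using in_dom_at[OF Mstr] in_dom_at[OF Hstr] by blast
  have x: "coord_at (mfd G) (unit G) (unit G) = (?x, ?y)" by (simp add: dcp_simps)
  have X: "?X \<eta> (?x, ?y) = (0, ?Y \<eta> ?y)" for \<eta>
    using local_rep_vertical[of ?x ?y] i by blast
  have "((\<lambda>z. ?Y \<eta> (snd z)) has_derivative (\<lambda>w. frechet_derivative (?Y \<eta>) (at ?y) (snd w))) (at (?x, ?y))" for \<eta>
    using diff_chain_at[OF bounded_linear_imp_has_derivative[OF bounded_linear_snd], of "?Y \<eta>"]
      HH.left_invariant_field_has_derivative[of \<eta>] by (force simp: o_def)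
  then have "((\<lambda>z. (0, ?Y \<eta> (snd z))) has_derivative
      (\<lambda>w. (0, frechet_derivative (?Y \<eta>) (at ?y) (snd w)))) (at (?x, ?y))" for \<eta>
    by (intro has_derivative_Pair has_derivative_const)
  then have "(?X \<eta> has_derivative (\<lambda>w. (0, frechet_derivative (?Y \<eta>) (at ?y) (snd w)))) (at (?x, ?y))" for \<eta>
    by (rule has_derivative_transform_within_open[OF _ op i]) (auto simp: local_rep_vertical)
  from frechet_derivative_at[OF this]
  have "frechet_derivative (?X \<eta>) (at (?x, ?y)) = (\<lambda>w. (0, frechet_derivative (?Y \<eta>) (at ?y) (snd w)))" for \<eta>
    by simp
  then show ?thesis
    unfolding dcp.lie_bracket_eq HH.lie_bracket_eq Let_def x by (simp add: X)
qed

text \<open>The four component maps are defined by brackets of pure elements, so the general bracket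
  follows by bilinearity; the mixed terms in \<open>\<zeta>\<close> and \<open>v\<close> carry a minus sign by antisymmetry.\<close>

lemma lie_bracket_dcp:
  "lie_bracket G (v, \<eta>) (w, \<zeta>) =
    (dbracket P v w + lact P \<eta> w - lact P \<zeta> v,
     lie_bracket (HH P) \<eta> \<zeta> + psi P \<eta> w - psi P \<zeta> v + theta P v w)"
proof -
  have "lie_bracket G (v, \<eta>) (w, \<zeta>) = lie_bracket G ((v, 0) + (0, \<eta>)) ((w, 0) + (0, \<zeta>))" by simp
  also have "\<dots> = lie_bracket G (v, 0) (w, 0) - lie_bracket G (0, \<zeta>) (v, 0)
      + lie_bracket G (0, \<eta>) (w, 0) + lie_bracket G (0, \<eta>) (0, \<zeta>)"
    unfolding dcp.lie_bracket_add_left dcp.lie_bracket_add_right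
    by (simp add: dcp.lie_bracket_antisym[of "(v, 0)" "(0, \<zeta>)"])
  also have "\<dots> = (dbracket P v w + lact P \<eta> w - lact P \<zeta> v,
     lie_bracket (HH P) \<eta> \<zeta> + psi P \<eta> w - psi P \<zeta> v + theta P v w)"
    by (rule prod_eqI) (simp_all add: dbracket_def theta_def lact_def psi_def lie_bracket_vertical)
  finally show ?thesis .
qed

lemma bounded_linear_components:
  "bounded_linear (lact P \<eta>)" "bounded_linear (psi P \<eta>)" "bounded_linear (\<lambda>\<eta>. lact P \<eta> v)"
  "bounded_linear (\<lambda>\<eta>. psi P \<eta> v)" "bounded_linear (dbracket P v)" "bounded_linear (theta P v)"
proof -
  have "bounded_linear (\<lambda>w::'e. (w, 0::'f))" "bounded_linear (\<lambda>\<zeta>::'f. (0::'e, \<zeta>))"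
    by (auto intro!: bounded_linear_Pair bounded_linear_ident bounded_linear_zero)
  note c = bounded_linear_compose[OF dcp.bounded_linear_lie_bracket this(1)]
    bounded_linear_compose[OF dcp.bounded_linear_lie_bracket this(2)]
  note fst = bounded_linear_compose[OF bounded_linear_fst] and snd = bounded_linear_compose[OF bounded_linear_snd]
  show "bounded_linear (lact P \<eta>)" "bounded_linear (psi P \<eta>)"
    "bounded_linear (dbracket P v)" "bounded_linear (theta P v)"
    unfolding lact_def psi_def dbracket_def theta_def by (intro fst snd c)+
  show "bounded_linear (\<lambda>\<eta>. lact P \<eta> v)" "bounded_linear (\<lambda>\<eta>. psi P \<eta> v)"
    unfolding lact_def psi_def dcp.lie_bracket_antisym[of "(0, _)" "(v, 0)"]
    by (intro fst snd bounded_linear_minus c)+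
qed

end

section \<open>Splitting the Euler-Lagrange equation\<close>

text \<open>Restricting a covector to the factors and recombining the restrictions are compositions with
  fixed bounded maps, and these commute with differentiation in time.\<close>

lemma has_vector_derivative_dual_prod_iff:
  fixes A :: "real \<Rightarrow> ('a::real_normed_vector \<times> 'b::real_normed_vector) \<Rightarrow>\<^sub>L real"
    and D :: "('a \<times> 'b) \<Rightarrow>\<^sub>L real"
  assumes A: "\<And>s a b. blinfun_apply (A s) (a, b) = blinfun_apply (B s) a + blinfun_apply (C s) b"
    and D: "\<And>a b. blinfun_apply D (a, b) = blinfun_apply D1 a + blinfun_apply D2 b"
  shows "(A has_vector_derivative D) (at t) \<longleftrightarrow>
    (B has_vector_derivative D1) (at t) \<and> (C has_vector_derivative D2) (at t)"
proof -
  define i1 where "i1 = Blinfun (\<lambda>a::'a. (a, 0::'b))"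
  define i2 where "i2 = Blinfun (\<lambda>b::'b. (0::'a, b))"
  define p1 where "p1 = Blinfun (fst :: 'a \<times> 'b \<Rightarrow> 'a)"
  define p2 where "p2 = Blinfun (snd :: 'a \<times> 'b \<Rightarrow> 'b)"
  have ap: "blinfun_apply i1 a = (a, 0)" "blinfun_apply i2 b = (0, b)"
    "blinfun_apply p1 z = fst z" "blinfun_apply p2 z = snd z" for a b z
    unfolding i1_def i2_def p1_def p2_def
    by (simp_all add: bounded_linear_Blinfun_apply bounded_linear_Pair bounded_linear_ident
        bounded_linear_zero bounded_linear_fst bounded_linear_snd)
  have B: "B = (\<lambda>s. A s o\<^sub>L i1)" "D1 = D o\<^sub>L i1" and C: "C = (\<lambda>s. A s o\<^sub>L i2)" "D2 = D o\<^sub>L i2"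
    by (auto intro!: ext blinfun_eqI simp: ap A D)
  have A': "A = (\<lambda>s. (B s o\<^sub>L p1) + (C s o\<^sub>L p2))" "D = (D1 o\<^sub>L p1) + (D2 o\<^sub>L p2)"
    using A D by (auto intro!: ext blinfun_eqI simp: ap blinfun.add_left)
  note cmp = bounded_linear.has_vector_derivative[OF bounded_bilinear.bounded_linear_left[OF bounded_bilinear_blinfun_compose]]
  show ?thesis
  proof (intro iffI conjI)
    assume "(A has_vector_derivative D) (at t)"
    then show "(B has_vector_derivative D1) (at t)" "(C has_vector_derivative D2) (at t)"
      unfolding B C by (rule cmp)+
  next
    assume "(B has_vector_derivative D1) (at t) \<and> (C has_vector_derivative D2) (at t)"
    then show "(A has_vector_derivative D) (at t)"
      by (subst A'(1), subst A'(2)) (intro has_vector_derivative_add cmp; simp)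
  qed
qed

lemma transpose_map_apply:
  "bounded_linear f \<Longrightarrow> blinfun_apply (transpose_map f \<alpha>) w = \<alpha> (f w)"
  by (simp add: transpose_map_def bounded_linear_Blinfun_apply)

lemma smooth_structure_real: "smooth_structure (vs_manifold :: (real, real) manifold_data)"
proof (rule smooth_structure_vs_manifold, intro exI conjI)
  show "span {1::real} = UNIV" by (auto simp: span_singleton)
qed simp

context cocycle_pair
begin

text \<open>Joint smoothness of the Lagrangian makes its restriction to either factor of
  \<open>G \<times> (T\<^sub>oM \<times> \<hh>)\<close> smooth; each of these factors is again a product manifold, on which
  \<open>tangent_map_partial\<close> applies.\<close>

lemma differential_dcp_split:
  fixes L :: "'m \<times> 'h \<Rightarrow> 'e \<times> 'f \<Rightarrow> real"
  assumes L: "smooth_map (prod_manifold (mfd G) vs_manifold) vs_manifold (\<lambda>(g, \<xi>). L g \<xi>)"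
  shows "blinfun_apply (differential (mfd G) (\<lambda>k. L k \<xi>) (m, h)) (w, \<zeta>)
      = differential M (\<lambda>x. L (x, h) \<xi>) m w + differential H (\<lambda>x. L (m, x) \<xi>) h \<zeta>"
    and "blinfun_apply (differential vs_manifold (L g) (v, \<eta>)) (w, \<zeta>)
      = differential vs_manifold (\<lambda>x. L g (x, \<eta>)) v w + differential vs_manifold (\<lambda>x. L g (v, x)) \<eta> \<zeta>"
proof -
  have E: "smooth_structure (vs_manifold :: ('e, 'e) manifold_data)"
    and F: "smooth_structure (vs_manifold :: ('f, 'f) manifold_data)"
    by (rule smooth_structure_vs_manifold, rule smooth_structure_finite_dim, rule Mstr)
      (rule smooth_structure_vs_manifold, rule smooth_structure_finite_dim, rule Hstr)
  have EF: "smooth_structure (vs_manifold :: ('e \<times> 'f, 'e \<times> 'f) manifold_data)"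
    using smooth_structure_prod[OF E F] by (simp add: prod_vs_manifold)
  note smL = smooth_map_imp_smooth_at[OF smooth_structure_prod[OF Gstr EF] smooth_structure_real L]
  have 1: "smooth_at (prod_manifold M H) vs_manifold (\<lambda>k. L k \<xi>) (m, h)"
    using smooth_at_partial(1)[OF Gstr EF smL[of "((m, h), \<xi>)"]] by (simp add: dcp_simps)
  have 2: "smooth_at (prod_manifold vs_manifold vs_manifold) vs_manifold (L g) (v, \<eta>)"
    using smooth_at_partial(2)[OF Gstr EF smL[of "(g, (v, \<eta>))"]] by (simp add: prod_vs_manifold)
  show "blinfun_apply (differential (mfd G) (\<lambda>k. L k \<xi>) (m, h)) (w, \<zeta>)
      = differential M (\<lambda>x. L (x, h) \<xi>) m w + differential H (\<lambda>x. L (m, x) \<xi>) h \<zeta>"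
    using tangent_map_partial[OF Mstr Hstr 1] by (simp add: differential_def dcp_simps)
  show "blinfun_apply (differential vs_manifold (L g) (v, \<eta>)) (w, \<zeta>)
      = differential vs_manifold (\<lambda>x. L g (x, \<eta>)) v w + differential vs_manifold (\<lambda>x. L g (v, x)) \<eta> \<zeta>"
    using tangent_map_partial[OF E F 2] by (simp add: differential_def prod_vs_manifold)
qed

end

theorem proposition3p5:
  fixes P :: "('m::{t2_space,second_countable_topology}, 'e::real_normed_vector,
               'h::{t2_space,second_countable_topology}, 'f::real_normed_vector) matched_pair_data"
    and L :: "'m \<times> 'h \<Rightarrow> 'e \<times> 'f \<Rightarrow> real"
    and I :: "real set" and t :: real
    and m :: "real \<Rightarrow> 'm" and h :: "real \<Rightarrow> 'h" and v :: "real \<Rightarrow> 'e" and \<eta> :: "real \<Rightarrow> 'f"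
  assumes "cocycle_matched_pair P"
    and "smooth_map (prod_manifold (mfd (cocycle_dcp P)) vs_manifold) vs_manifold (\<lambda>(g, \<xi>). L g \<xi>)"
    and "open I" and "is_interval I" and "t \<in> I"
    and "smooth_map_on vs_manifold (MM P) I m"
    and "smooth_map_on vs_manifold (mfd (HH P)) I h"
    and "smooth_on I v" and "smooth_on I \<eta>"
  shows "euler_lagrange_at (cocycle_dcp P) L (\<lambda>s. (m s, h s)) (\<lambda>s. (v s, \<eta> s)) t \<longleftrightarrow>
    (let M = MM P; H = mfd (HH P); mul = mult (HH P);
         dL_dm = (\<lambda>s. differential M (\<lambda>x. L (x, h s) (v s, \<eta> s)) (m s));
         dL_dh = (\<lambda>s. differential H (\<lambda>x. L (m s, x) (v s, \<eta> s)) (h s));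
         dL_dv = (\<lambda>s. differential vs_manifold (\<lambda>x. L (m s, h s) (x, \<eta> s)) (v s));
         dL_deta = (\<lambda>s. differential vs_manifold (\<lambda>x. L (m s, h s) (v s, x)) (\<eta> s))
     in (dL_dv has_vector_derivative
           coact_grp P (cotangent_map M M (\<lambda>n. dot P (m t) n) (base P) (dL_dm t)) (h t)
         + coact_grp P (cotangent_map M H (\<lambda>n. mul (gam P (m t) n) (h t)) (base P) (dL_dh t)) (h t)
         + cotangent_map M H (\<lambda>n. sig P (h t) n) (base P) (dL_dh t)
         - d_coad P (v t) (dL_dv t)
         + coact_alg P (dL_dv t) (\<eta> t)
         + a_star P (\<eta> t) (dL_deta t)
         + theta_star P (v t) (dL_deta t)) (at t)
      \<and> (dL_deta has_vector_derivative
           cotangent_map H H (\<lambda>k. mul (h t) k) (unit (HH P)) (dL_dh t)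
         - coad (HH P) (\<eta> t) (dL_deta t)
         - b_star P (v t) (dL_dv t)
         - psi_star P (v t) (dL_deta t)) (at t))"
proof -
  interpret cocycle_pair P by unfold_locales (rule assms(1))
  note split = differential_dcp_split[OF assms(2)]
  show ?thesis
    \<comment> \<open>both sides are tested on a vector \<open>(w, \<zeta>)\<close>: the first equation collects the terms in \<open>w\<close>,\<close>
    \<comment> \<open>the second one those in \<open>\<zeta>\<close>\<close>
    unfolding euler_lagrange_at_def Let_def
  proof (rule has_vector_derivative_dual_prod_iff, rule split(2))
    fix w \<zeta>
    let ?dm = "differential M (\<lambda>x. L (x, h t) (v t, \<eta> t)) (m t)"
    let ?dh = "differential H (\<lambda>x. L (m t, x) (v t, \<eta> t)) (h t)"
    let ?dv = "differential vs_manifold (\<lambda>x. L (m t, h t) (x, \<eta> t)) (v t)"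
    let ?de = "differential vs_manifold (\<lambda>x. L (m t, h t) (v t, x)) (\<eta> t)"
    show "blinfun_apply
       (cotangent_map (mfd G) (mfd G) (mult G (m t, h t)) (unit G)
         (differential (mfd G) (\<lambda>k. L k (v t, \<eta> t)) (m t, h t)) -
        coad G (v t, \<eta> t) (differential vs_manifold (L (m t, h t)) (v t, \<eta> t))) (w, \<zeta>) =
      blinfun_apply
       (coact_grp P (cotangent_map M M (dot P (m t)) b ?dm) (h t)
         + coact_grp P (cotangent_map M H (\<lambda>n. mul (gam P (m t) n) (h t)) b ?dh) (h t)
         + cotangent_map M H (sig P (h t)) b ?dh - d_coad P (v t) ?dv
         + coact_alg P ?dv (\<eta> t) + a_star P (\<eta> t) ?de + theta_star P (v t) ?de) w +
      blinfun_apply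
       (cotangent_map H H (mul (h t)) e ?dh - coad (HH P) (\<eta> t) ?de - b_star P (v t) ?dv
         - psi_star P (v t) ?de) \<zeta>"
      by (simp add: cotangent_map_def coact_grp_def coad_def d_coad_def coact_alg_def a_star_def
          b_star_def psi_star_def theta_star_def transpose_map_apply bounded_linear_components
          dcp.bounded_linear_lie_bracket HH.bounded_linear_lie_bracket
          tangent_map_mult_dcp split lie_bracket_dcp blinfun.bilinear_simps)
  qed
qed

end
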